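(* Let $A\in\mathbb{R}^{n\times n}$, $B\in\mathbb{R}^{n\times m}$, and let $\mathcal{A}\in\{0,*\}^{n\times n}$, $\mathcal{B}\in\{0,*\}^{n\times m}$ be pattern matrices. The following statements are equivalent: 1) The perturbed system is structurally controllable, i.e. there exist $\Delta A\in[\mathcal{A}]$ and $\Delta B\in[\mathcal{B}]$ such that $(A+\Delta A,B+\Delta B)$ is controllable. 2) (a) For each eigenvalue $\lambda_i\in\sigma(A)$, $$\max_{\Delta A\in[\mathcal{A}],\,\Delta B\in[\mathcal{B}]}\operatorname{rank}[\lambda_i I-A-\Delta A,\;B+\Delta B]=n;$$ and (b) every edge $e\in E_{xz}$ of the auxiliary connection digraph $\mathcal{G}_{\rm auc}$ is input-reachable. 3) (a) For each $\lambda_i\in\sigma(A)$, the intersection of the column matroid of the $n\times(2n+m)$ matrix $[I_n,\ \lambda_i I-A,\ B]$ and the column matroid of the $(n+m)\times(2n+m)$ matrix $[[\mathcal{A},\mathcal{B}]^\intercal,\ \bar I_{n+m}]$ (both on the ground set $[2n+m]$) has cardinality $n$; and (b) every vertex $z_i\in V_z$ is input-reachable in $\mathcal{G}_{\rm auc}$.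
   Context: A pattern matrix is a matrix with entries in $\{0,*\}$. For $\mathcal{M}\in\{0,*\}^{n_1\times n_2}$, $[\mathcal{M}]=\{M\in\mathbb{R}^{n_1\times n_2}: M_{ij}=0 \text{ whenever } \mathcal{M}_{ij}=0\}$. The generic rank $\operatorname{grank}\mathcal{M}$ is the maximum rank of an element of $[\mathcal{M}]$. $\bar I_k$ denotes the $k\times k$ diagonal pattern matrix with all diagonal entries $*$. Controllability of $(A,B)$ means the controllability matrix $[B,AB,\dots,A^{n-1}B]$ has rank $n$; $\sigma(A)$ is the set of (complex) eigenvalues of $A$, and ranks with complex $\lambda_i$ are over $\mathbb{C}$. For a matrix $W$ with $q$ columns (possibly containing pattern/free entries), its column matroid is $([q],\mathcal{I}_W)$ with $\mathcal{I}_W=\{I\subseteq[q]: \operatorname{rank}W(:,I)=|I|\}$ (using generic rank when $W$ contains $*$ entries, treating the $*$ entries as independent free parameters). The cardinality of the intersection of two matroids on the same ground set is the maximum size of a set independent in both. Auxiliary connection digraph (ACG) $\mathcal{G}_{\rm auc}$: define the rational matrices $G_{zx}(\lambda)=\begin{bmatrix}(\lambda I-A)^{-1}\\ 0_{m\times n}\end{bmatrix}$ and $G_{zu}(\lambda)=\begin{bmatrix}(\lambda I-A)^{-1}B\\ I_m\end{bmatrix}$ (both $(n+m)$-row). Vertex set $V_z\cup V_x\cup V_u$ with $V_z=\{z_1,\dots,z_{n+m}\}$, $V_x=\{x_1,\dots,x_n\}$, $V_u=\{u_1,\dots,u_m\}$. Edge set $E_{xz}\cup E_{uz}\cup E_{zx}$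 where $E_{xz}=\{(x_j,z_i): [G_{zx}(\lambda)]_{ij}\not\equiv 0\}$, $E_{uz}=\{(u_j,z_i):[G_{zu}(\lambda)]_{ij}\not\equiv0\}$, $E_{zx}=\{(z_i,x_j): [\mathcal{A},\mathcal{B}]_{ji}=*\}$. A vertex is input-reachable if there is a directed path from some vertex of $V_u$ ending at it; an edge in $E_{xz}$ is input-reachable if its start or end vertex is input-reachable. *)

theory Defs
  imports Complex_Main "Jordan_Normal_Form.DL_Rank_Submatrix" "Jordan_Normal_Form.Char_Poly"
begin

text \<open>Pattern matrices: entries True = *, False = 0.\<close>
type_synonym pattern = "bool mat"

definition realizations :: "pattern \<Rightarrow> real mat set" where
  "realizations P = {M. M \<in> carrier_mat (dim_row P) (dim_col P) \<and>
     (\<forall>i<dim_row P. \<forall>j<dim_col P. \<not> P $$ (i,j) \<longrightarrow> M $$ (i,j) = 0)}"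

text \<open>Horizontal concatenation [M, N].\<close>
definition hconcat :: "'a mat \<Rightarrow> 'a mat \<Rightarrow> 'a mat" where
  "hconcat M N = mat (dim_row M) (dim_col M + dim_col N)
     (\<lambda>(i,j). if j < dim_col M then M $$ (i,j) else N $$ (i, j - dim_col M))"

text \<open>The diagonal pattern \<open>\<bar>I\<^sub>k\<close>.\<close>
definition diag_pattern :: "nat \<Rightarrow> pattern" where
  "diag_pattern k = mat k k (\<lambda>(i,j). i = j)"

text \<open>Controllability matrix [B, AB, ..., A^(n-1) B], n = dim_row A.\<close>
definition ctrb_mat :: "'a::comm_ring_1 mat \<Rightarrow> 'a mat \<Rightarrow> 'a mat" where
  "ctrb_mat A B = mat (dim_row A) (dim_row A * dim_col B)
     (\<lambda>(i,j). ((A ^\<^sub>m (j div dim_col B)) * B) $$ (i, j mod dim_col B))"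

definition controllable :: "real mat \<Rightarrow> real mat \<Rightarrow> bool" where
  "controllable A B = (vec_space.rank (dim_row A) (ctrb_mat A B) = dim_row A)"

definition cmat :: "real mat \<Rightarrow> complex mat" where
  "cmat M = map_mat complex_of_real M"

text \<open>Structural controllability of the perturbed system.\<close>
definition struct_controllable :: "real mat \<Rightarrow> real mat \<Rightarrow> pattern \<Rightarrow> pattern \<Rightarrow> bool" where
  "struct_controllable A B PA PB =
     (\<exists>dA \<in> realizations PA. \<exists>dB \<in> realizations PB. controllable (A + dA) (B + dB))"

text \<open>max over perturbations of rank [lambda I - A - dA, B + dB] (over the complex numbers).\<close>
definition max_pert_rank :: "real mat \<Rightarrow> real mat \<Rightarrow> pattern \<Rightarrow> pattern \<Rightarrow> complex \<Rightarrow> nat" where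
  "max_pert_rank A B PA PB lam = Max {vec_space.rank (dim_row A)
       (hconcat (lam \<cdot>\<^sub>m 1\<^sub>m (dim_row A) - cmat A - cmat dA) (cmat (B + dB))) |
       dA dB. dA \<in> realizations PA \<and> dB \<in> realizations PB}"

text \<open>Column matroid independence of a numeric matrix W.\<close>
definition col_indep :: "'a::field mat \<Rightarrow> nat set \<Rightarrow> bool" where
  "col_indep W I = (I \<subseteq> {..<dim_col W} \<and>
     vec_space.rank (dim_row W) (submatrix W {..<dim_row W} I) = card I)"

text \<open>Column matroid independence of a pattern matrix (generic rank, *-entries
  independent free parameters, i.e. maximal rank over all real realizations).\<close>
definition pattern_col_indep :: "pattern \<Rightarrow> nat set \<Rightarrow> bool" where
  "pattern_col_indep P I = (I \<subseteq> {..<dim_col P} \<and>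
     Max {vec_space.rank (dim_row P) (submatrix M {..<dim_row P} I) | M. M \<in> realizations P}
       = card I)"

text \<open>Cardinality of the intersection of two matroids on ground set {..<q}.\<close>
definition matroid_inter_card :: "nat \<Rightarrow> (nat set \<Rightarrow> bool) \<Rightarrow> (nat set \<Rightarrow> bool) \<Rightarrow> nat" where
  "matroid_inter_card q I1 I2 = Max {card I | I. I \<subseteq> {..<q} \<and> I1 I \<and> I2 I}"

text \<open>[[\<A>, \<B>]^T, \<bar>I_{n+m}]\<close>
definition W_pattern :: "pattern \<Rightarrow> pattern \<Rightarrow> pattern" where
  "W_pattern PA PB = hconcat (transpose_mat (hconcat PA PB)) (diag_pattern (dim_col PA + dim_col PB))"

text \<open>[I_n, lambda I - A, B]\<close>
definition W_num :: "real mat \<Rightarrow> real mat \<Rightarrow> complex \<Rightarrow> complex mat" where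
  "W_num A B lam = hconcat (hconcat (1\<^sub>m (dim_row A)) (lam \<cdot>\<^sub>m 1\<^sub>m (dim_row A) - cmat A)) (cmat B)"

text \<open>Auxiliary connection digraph.\<close>
datatype vertex = Z nat | X nat | U nat

text \<open>The rational function entry ((lambda I - A)^{-1} M)_{ij} is not identically zero,
  i.e. it is nonzero at some lambda where lambda I - A is invertible.\<close>
definition resolvent_entry_nz :: "real mat \<Rightarrow> real mat \<Rightarrow> nat \<Rightarrow> nat \<Rightarrow> bool" where
  "resolvent_entry_nz A M i j = (\<exists>lam::complex. \<exists>R \<in> carrier_mat (dim_row A) (dim_row A).
      R * (lam \<cdot>\<^sub>m 1\<^sub>m (dim_row A) - cmat A) = 1\<^sub>m (dim_row A) \<and> (R * cmat M) $$ (i,j) \<noteq> 0)"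

definition E_xz :: "real mat \<Rightarrow> real mat \<Rightarrow> (vertex \<times> vertex) set" where
  "E_xz A B = (let n = dim_row A; m = dim_col B in
     {(X j, Z i) | i j. i < n + m \<and> j < n \<and> i < n \<and> resolvent_entry_nz A (1\<^sub>m n) i j})"

definition E_uz :: "real mat \<Rightarrow> real mat \<Rightarrow> (vertex \<times> vertex) set" where
  "E_uz A B = (let n = dim_row A; m = dim_col B in
     {(U j, Z i) | i j. i < n + m \<and> j < m \<and>
        (if i < n then resolvent_entry_nz A B i j else i - n = j)})"

definition E_zx :: "pattern \<Rightarrow> pattern \<Rightarrow> (vertex \<times> vertex) set" where
  "E_zx PA PB = {(Z i, X j) | i j. i < dim_col PA + dim_col PB \<and> j < dim_row PA \<and>
      hconcat PA PB $$ (j, i)}"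

definition acg_edges :: "real mat \<Rightarrow> real mat \<Rightarrow> pattern \<Rightarrow> pattern \<Rightarrow> (vertex \<times> vertex) set" where
  "acg_edges A B PA PB = E_xz A B \<union> E_uz A B \<union> E_zx PA PB"

definition input_reachable :: "real mat \<Rightarrow> real mat \<Rightarrow> pattern \<Rightarrow> pattern \<Rightarrow> vertex \<Rightarrow> bool" where
  "input_reachable A B PA PB v = (\<exists>j < dim_col B. (U j, v) \<in> (acg_edges A B PA PB)\<^sup>*)"

definition edge_input_reachable :: "real mat \<Rightarrow> real mat \<Rightarrow> pattern \<Rightarrow> pattern \<Rightarrow> vertex \<times> vertex \<Rightarrow> bool" where
  "edge_input_reachable A B PA PB e =
     (input_reachable A B PA PB (fst e) \<or> input_reachable A B PA PB (snd e))"

end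

theory Submission
  imports Defs
    "HOL-Computational_Algebra.Fundamental_Theorem_Algebra"
begin

text \<open>
  Collect the free entries in a real parameter vector \<open>\<theta>\<close>. By the Popov--Belevitch--Hautus test,
  controllability means that the rows of the pencil \<open>[\<lambda>I - A - dA, B + dB]\<close> are independent at every
  \<open>\<lambda>\<close>, that is, that its maximal minors, which are affine in each single parameter, have no common
  root \<open>\<lambda>\<close>.

  Reachability of all \<open>z\<^sub>i\<close> yields parameters for which every column is avoided by some nonzero
  minor; among these choose one with the fewest common roots. A parameter in column \<open>i\<close> does not
  occur in a minor avoiding column \<open>i\<close>, whose roots are finite in number, so by minimality a generic
  move of that parameter keeps every common root. Since the parameters with these common roots are
  therefore Zariski dense, a common root would be one for all parameters, contradicting the rank
  condition. Conversely, the unit row vectors at unreachable \<open>z\<^sub>i\<close> lie in an invariant space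
  annihilating the perturbed \<open>B\<close>.

  The rank condition and the matroid condition agree because the perturbed pencil is the product
  of \<open>[I, \<lambda>I - A, B]\<close> with a realization of the transposed pattern matrix.
\<close>

section \<open>Linearly independent rows\<close>

definition indep_rows :: "'i set \<Rightarrow> 'k set \<Rightarrow> ('i \<Rightarrow> 'k \<Rightarrow> 'a::field) \<Rightarrow> bool" where
  "indep_rows I K h \<longleftrightarrow> (\<forall>q. (\<forall>k\<in>K. (\<Sum>i\<in>I. q i * h i k) = 0) \<longrightarrow> (\<forall>i\<in>I. q i = 0))"

lemma indep_rowsI:
  "(\<And>q i. (\<And>k. k \<in> K \<Longrightarrow> (\<Sum>i\<in>I. q i * h i k) = 0) \<Longrightarrow> i \<in> I \<Longrightarrow> q i = 0) \<Longrightarrow> indep_rows I K h"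
  unfolding indep_rows_def by blast

lemma indep_rowsD:
  "indep_rows I K h \<Longrightarrow> (\<And>k. k \<in> K \<Longrightarrow> (\<Sum>i\<in>I. q i * h i k) = 0) \<Longrightarrow> i \<in> I \<Longrightarrow> q i = 0"
  unfolding indep_rows_def by blast

lemma indep_rows_mono: "indep_rows I K h \<Longrightarrow> K \<subseteq> K' \<Longrightarrow> indep_rows I K' h"
  unfolding indep_rows_def by blast

lemma indep_rows_cong:
  assumes "\<And>i k. i \<in> I \<Longrightarrow> k \<in> K \<Longrightarrow> h i k = h' i k"
  shows "indep_rows I K h \<longleftrightarrow> indep_rows I K h'"
  unfolding indep_rows_def using assms by simp

lemma indep_rows_reindex:
  assumes "finite I"
  shows "indep_rows I K (\<lambda>i. h (f i)) \<longleftrightarrow> inj_on f I \<and> indep_rows (f ` I) K h"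
proof (intro iffI conjI)
  assume indep: "indep_rows I K (\<lambda>i. h (f i))"
  show inj: "inj_on f I"
  proof (rule inj_onI, rule ccontr)
    fix i j assume "i \<in> I" "j \<in> I" "f i = f j" "i \<noteq> j"
    define q :: "_ \<Rightarrow> 'c" where "q l = of_bool (l = i) - of_bool (l = j)" for l
    have "(\<Sum>l\<in>I. q l * h (f l) k) = h (f i) k - h (f j) k" for k
      using assms \<open>i \<in> I\<close> \<open>j \<in> I\<close>
      by (simp add: q_def left_diff_distrib sum_subtractf)
    then have "q i = 0" using indep_rowsD[OF indep, of q i] \<open>i \<in> I\<close> \<open>f i = f j\<close> by simp
    then show False using \<open>i \<noteq> j\<close> by (simp add: q_def)
  qed
  show "indep_rows (f ` I) K h"
  proof (rule indep_rowsI)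
    fix q l assume kernel: "\<And>k. k \<in> K \<Longrightarrow> (\<Sum>i\<in>f ` I. q i * h i k) = 0" and "l \<in> f ` I"
    then obtain i where "i \<in> I" "l = f i" by blast
    moreover have "(\<Sum>i\<in>I. q (f i) * h (f i) k) = 0" if "k \<in> K" for k
      using kernel[OF that] by (simp add: sum.reindex[OF inj])
    ultimately show "q l = 0" using indep_rowsD[OF indep, of "\<lambda>i. q (f i)" i] by simp
  qed
next
  assume reindexed: "inj_on f I \<and> indep_rows (f ` I) K h"
  show "indep_rows I K (\<lambda>i. h (f i))"
  proof (rule indep_rowsI)
    fix q i assume kernel: "\<And>k. k \<in> K \<Longrightarrow> (\<Sum>i\<in>I. q i * h (f i) k) = 0" and i: "i \<in> I"
    define q' where "q' = (\<lambda>l. q (inv_into I f l))"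
    have q': "q' (f i) = q i" if "i \<in> I" for i using reindexed that by (simp add: q'_def)
    have "(\<Sum>l\<in>f ` I. q' l * h l k) = (\<Sum>i\<in>I. q i * h (f i) k)" for k
      using reindexed q' by (simp add: sum.reindex)
    then have "q' (f i) = 0" using indep_rowsD[of "f ` I" K h q' "f i"] reindexed kernel i by simp
    then show "q i = 0" using q' i by simp
  qed
qed

lemma indep_rows_bij_betw:
  assumes "finite I'" "bij_betw e I' I" "f ` K' = K"
  shows "indep_rows I' K' (\<lambda>a b. h (e a) (f b)) \<longleftrightarrow> indep_rows I K h"
proof -
  have "indep_rows I' K' (\<lambda>a b. h (e a) (f b)) \<longleftrightarrow> indep_rows I' K (\<lambda>a. h (e a))"
    unfolding indep_rows_def assms(3)[symmetric] by simp
  then show ?thesis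
    using assms(2) indep_rows_reindex[OF assms(1), of K h e] by (auto simp: bij_betw_def)
qed

lemma det_ne_0_iff_indep_rows:
  fixes h :: "nat \<Rightarrow> nat \<Rightarrow> 'a::field"
  shows "det (mat n n (\<lambda>(i,k). h i k)) \<noteq> 0 \<longleftrightarrow> indep_rows {..<n} {..<n} h"
proof -
  let ?T = "mat n n (\<lambda>(k,i). h i k)"
  have "?T = transpose_mat (mat n n (\<lambda>(i,k). h i k))" by (intro eq_matI) auto
  then have "det (mat n n (\<lambda>(i,k). h i k)) = det ?T"
    by (simp add: det_transpose[of _ n])
  also have "\<dots> \<noteq> 0 \<longleftrightarrow> (\<forall>v. v \<in> carrier_vec n \<longrightarrow> ?T *\<^sub>v v = 0\<^sub>v n \<longrightarrow> v = 0\<^sub>v n)"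
    by (subst det_0_iff_vec_prod_zero_field[of _ n]) auto
  also have "\<dots> \<longleftrightarrow> indep_rows {..<n} {..<n} h"
  proof -
    have kernel: "?T *\<^sub>v v = 0\<^sub>v n \<longleftrightarrow> (\<forall>k<n. (\<Sum>i<n. v $ i * h i k) = 0)" if "v \<in> carrier_vec n" for v
      using that by (simp add: vec_eq_iff scalar_prod_def atLeast0LessThan mult.commute)
    have zero: "v = 0\<^sub>v n \<longleftrightarrow> (\<forall>i<n. v $ i = 0)" if "v \<in> carrier_vec n" for v :: "'a vec"
      using that by (auto simp: vec_eq_iff)
    have vec: "\<exists>v \<in> carrier_vec n. \<forall>i<n. v $ i = q i" for q :: "nat \<Rightarrow> 'a"
      by (rule bexI[of _ "vec n q"]) auto
    show ?thesis
    proof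
      assume inj: "\<forall>v. v \<in> carrier_vec n \<longrightarrow> ?T *\<^sub>v v = 0\<^sub>v n \<longrightarrow> v = 0\<^sub>v n"
      show "indep_rows {..<n} {..<n} h"
      proof (rule indep_rowsI)
        fix q i assume q: "\<And>k. k \<in> {..<n} \<Longrightarrow> (\<Sum>i<n. q i * h i k) = 0" and i: "i \<in> {..<n}"
        obtain v where v: "v \<in> carrier_vec n" "\<And>i. i < n \<Longrightarrow> v $ i = q i" using vec by blast
        then show "q i = 0"
          using inj[rule_format, OF v(1)] kernel[OF v(1)] zero[OF v(1)] q i by simp
      qed
    next
      assume indep: "indep_rows {..<n} {..<n} h"
      show "\<forall>v. v \<in> carrier_vec n \<longrightarrow> ?T *\<^sub>v v = 0\<^sub>v n \<longrightarrow> v = 0\<^sub>v n"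
      proof (intro allI impI)
        fix v assume v: "v \<in> carrier_vec n" and "?T *\<^sub>v v = 0\<^sub>v n"
        then have "(\<Sum>i<n. v $ i * h i k) = 0" if "k \<in> {..<n}" for k using kernel[OF v] that by simp
        then have "v $ i = 0" if "i < n" for i
          using indep_rowsD[OF indep, of "\<lambda>i. v $ i" i] that by simp
        then show "v = 0\<^sub>v n" using zero[OF v] by simp
      qed
    qed
  qed
  finally show ?thesis .
qed

lemma indep_rows_transpose:
  assumes "finite I" "finite K" "card I = card K"
  shows "indep_rows I K h \<longleftrightarrow> indep_rows K I (\<lambda>k i. h i k)"
proof -
  obtain e f where e: "bij_betw e {..<card I} I" and f: "bij_betw f {..<card I} K"
    using assms ex_bij_betw_nat_finite atLeast0LessThan by metis
  have "indep_rows I K h \<longleftrightarrow> det (mat (card I) (card I) (\<lambda>(a,b). h (e a) (f b))) \<noteq> 0"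
    unfolding det_ne_0_iff_indep_rows
    by (rule indep_rows_bij_betw[symmetric]) (use e f in \<open>auto simp: bij_betw_def\<close>)
  also have "mat (card I) (card I) (\<lambda>(a,b). h (e a) (f b)) =
      transpose_mat (mat (card I) (card I) (\<lambda>(b,a). h (e a) (f b)))"
    by (intro eq_matI) auto
  also have "det \<dots> \<noteq> 0 \<longleftrightarrow> indep_rows {..<card I} {..<card I} (\<lambda>b a. h (e a) (f b))"
    unfolding det_ne_0_iff_indep_rows[symmetric] by (simp add: det_transpose[of _ "card I"])
  also have "\<dots> \<longleftrightarrow> indep_rows K I (\<lambda>k i. h i k)"
    by (rule indep_rows_bij_betw) (use e f in \<open>auto simp: bij_betw_def\<close>)
  finally show ?thesis .
qed

lemma indep_rows_imp_card_le:
  assumes "finite I" "finite K" "indep_rows I K h"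
  shows "card I \<le> card K"
proof (rule ccontr)
  assume "\<not> card I \<le> card K"
  then have less: "card K < card I" by simp
  obtain e f where e: "bij_betw e {..<card I} I" and f: "bij_betw f {..<card K} K"
    using assms ex_bij_betw_nat_finite atLeast0LessThan by metis
  define h' where "h' a b = (if b < card K then h (e a) (f b) else 0)" for a b
  have "indep_rows {..<card I} {..<card K} (\<lambda>a b. h (e a) (f b))"
    using assms(3) e f by (subst indep_rows_bij_betw) (auto simp: bij_betw_def)
  also have "indep_rows {..<card I} {..<card K} (\<lambda>a b. h (e a) (f b)) \<longleftrightarrow>
      indep_rows {..<card I} {..<card K} h'"
    by (rule indep_rows_cong) (simp add: h'_def)
  finally have "indep_rows {..<card I} {..<card I} h'"
    by (rule indep_rows_mono) (use less in auto)
  then have "indep_rows {..<card I} {..<card I} (\<lambda>b a. h' a b)"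
    by (subst (asm) indep_rows_transpose) auto
  from indep_rowsD[OF this, of "\<lambda>b. of_bool (b = card K)" "card K"] show False
    using less by (simp add: h'_def sum.neutral)
qed

lemma indep_rows_basis:
  assumes "finite I" "finite K" "indep_rows I K h"
  obtains L where "L \<subseteq> K" "card L = card I" "indep_rows I L h"
proof -
  let ?C = "{L. L \<subseteq> K \<and> indep_rows I L h}"
  have "finite ?C" "?C \<noteq> {}" using assms(2,3) by auto
  then obtain L where "L \<in> ?C" and minimal: "\<And>L'. L' \<in> ?C \<Longrightarrow> L' \<subseteq> L \<Longrightarrow> L = L'"
    by (meson finite_has_minimal)
  then have L: "L \<subseteq> K" "indep_rows I L h" by auto
  have finL: "finite L" using L(1) assms(2) finite_subset by blast
  have "indep_rows L I (\<lambda>k i. h i k)"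
  proof (rule indep_rowsI, rule ccontr)
    fix c l assume c: "\<And>i. i \<in> I \<Longrightarrow> (\<Sum>k\<in>L. c k * h i k) = 0" and l: "l \<in> L" "c l \<noteq> 0"
    have "\<not> indep_rows I (L - {l}) h" using minimal[of "L - {l}"] L(1) l(1) by blast
    then obtain q j where q: "\<And>k. k \<in> L - {l} \<Longrightarrow> (\<Sum>i\<in>I. q i * h i k) = 0" and j: "j \<in> I" "q j \<noteq> 0"
      unfolding indep_rows_def by blast
    have "0 = (\<Sum>i\<in>I. q i * (\<Sum>k\<in>L. c k * h i k))" by (simp add: c)
    also have "\<dots> = (\<Sum>k\<in>L. c k * (\<Sum>i\<in>I. q i * h i k))"
      unfolding sum_distrib_left by (subst sum.swap) (simp add: ac_simps)
    also have "\<dots> = c l * (\<Sum>i\<in>I. q i * h i l)"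
      using finL l(1) q by (simp add: sum.remove[of L l])
    finally have "(\<Sum>i\<in>I. q i * h i l) = 0" using l(2) by simp
    then have "(\<Sum>i\<in>I. q i * h i k) = 0" if "k \<in> L" for k using q that by blast
    then show False using indep_rowsD[OF L(2), of q j] j by blast
  qed
  then have "card L \<le> card I" by (rule indep_rows_imp_card_le[OF finL assms(1)])
  moreover have "card I \<le> card L" by (rule indep_rows_imp_card_le[OF assms(1) finL L(2)])
  ultimately show thesis using that L by simp
qed

lemma indep_rows_iff_minor:
  assumes e: "bij_betw e {..<p} I" and "finite K"
  shows "indep_rows I K h \<longleftrightarrow>
    (\<exists>f. inj_on f {..<p} \<and> f ` {..<p} \<subseteq> K \<and> det (mat p p (\<lambda>(a,b). h (e a) (f b))) \<noteq> 0)"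
proof
  have I: "finite I" "card I = p" using bij_betw_finite[OF e] bij_betw_same_card[OF e] by auto
  assume "indep_rows I K h"
  then obtain L where L: "L \<subseteq> K" "card L = p" "indep_rows I L h"
    by (rule indep_rows_basis[OF I(1) \<open>finite K\<close>, unfolded I(2)])
  obtain f where f: "bij_betw f {..<p} L"
    using L(1,2) \<open>finite K\<close> ex_bij_betw_nat_finite[of L] finite_subset atLeast0LessThan by metis
  have "indep_rows {..<p} {..<p} (\<lambda>a b. h (e a) (f b))"
    using e f L(3) by (subst indep_rows_bij_betw) (auto simp: bij_betw_def)
  then show "\<exists>f. inj_on f {..<p} \<and> f ` {..<p} \<subseteq> K \<and> det (mat p p (\<lambda>(a,b). h (e a) (f b))) \<noteq> 0"
    using f L(1) unfolding det_ne_0_iff_indep_rows bij_betw_def by blast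
next
  assume "\<exists>f. inj_on f {..<p} \<and> f ` {..<p} \<subseteq> K \<and> det (mat p p (\<lambda>(a,b). h (e a) (f b))) \<noteq> 0"
  then obtain f where f: "f ` {..<p} \<subseteq> K" "indep_rows {..<p} {..<p} (\<lambda>a b. h (e a) (f b))"
    unfolding det_ne_0_iff_indep_rows by blast
  then have "indep_rows I (f ` {..<p}) h"
    using indep_rows_bij_betw[OF finite_lessThan e refl] by blast
  then show "indep_rows I K h" using f(1) by (rule indep_rows_mono)
qed

lemma indep_rows_mult:
  assumes "finite K" and h: "indep_rows I K h" and c: "indep_rows K L c"
  shows "indep_rows I L (\<lambda>i l. \<Sum>k\<in>K. h i k * c k l)"
proof (rule indep_rowsI)
  fix q i assume kernel: "\<And>l. l \<in> L \<Longrightarrow> (\<Sum>i\<in>I. q i * (\<Sum>k\<in>K. h i k * c k l)) = 0" and "i \<in> I"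
  have "(\<Sum>k\<in>K. (\<Sum>i\<in>I. q i * h i k) * c k l) = (\<Sum>i\<in>I. q i * (\<Sum>k\<in>K. h i k * c k l))" for l
    unfolding sum_distrib_left sum_distrib_right by (subst sum.swap) (simp add: mult.assoc)
  then have "(\<Sum>i\<in>I. q i * h i k) = 0" if "k \<in> K" for k
    using indep_rowsD[OF c, of "\<lambda>k. \<Sum>i\<in>I. q i * h i k" k] kernel that by simp
  then show "q i = 0" using indep_rowsD[OF h, of q i] \<open>i \<in> I\<close> by simp
qed

lemma indep_rows_scale_cols:
  assumes "\<And>k. k \<in> K \<Longrightarrow> c k \<noteq> 0"
  shows "indep_rows I K (\<lambda>i k. h i k * c k) \<longleftrightarrow> indep_rows I K h"
proof -
  have "(\<Sum>i\<in>I. q i * (h i k * c k)) = (\<Sum>i\<in>I. q i * h i k) * c k" for q k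
    by (simp add: sum_distrib_right mult.assoc)
  then show ?thesis unfolding indep_rows_def using assms by simp
qed

lemma indep_rows_complex_of_real:
  "indep_rows I K (\<lambda>i k. complex_of_real (h i k)) \<longleftrightarrow> indep_rows I K h"
proof
  assume indep: "indep_rows I K (\<lambda>i k. complex_of_real (h i k))"
  show "indep_rows I K h"
  proof (rule indep_rowsI)
    fix q i assume kernel: "\<And>k. k \<in> K \<Longrightarrow> (\<Sum>i\<in>I. q i * h i k) = 0" and "i \<in> I"
    have "(\<Sum>i\<in>I. complex_of_real (q i) * of_real (h i k)) = 0" if "k \<in> K" for k
      using kernel[OF that] by (simp flip: of_real_mult of_real_sum)
    then show "q i = 0"
      using indep_rowsD[OF indep, of "\<lambda>i. of_real (q i)" i] \<open>i \<in> I\<close> by simp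
  qed
next
  assume indep: "indep_rows I K h"
  show "indep_rows I K (\<lambda>i k. complex_of_real (h i k))"
  proof (rule indep_rowsI)
    fix q i assume kernel: "\<And>k. k \<in> K \<Longrightarrow> (\<Sum>i\<in>I. q i * complex_of_real (h i k)) = 0" and "i \<in> I"
    have "(\<Sum>i\<in>I. Re (q i) * h i k) = 0" "(\<Sum>i\<in>I. Im (q i) * h i k) = 0" if "k \<in> K" for k
      using arg_cong[OF kernel[OF that], of Re] arg_cong[OF kernel[OF that], of Im] by simp_all
    then have "Re (q i) = 0" "Im (q i) = 0"
      using indep_rowsD[OF indep, of "\<lambda>i. Re (q i)" i] indep_rowsD[OF indep, of "\<lambda>i. Im (q i)" i]
        \<open>i \<in> I\<close> by simp_all
    then show "q i = 0" by (simp add: complex_eq_iff)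
  qed
qed

section \<open>Rank\<close>

lemma lin_indpt_cols_iff_indep_rows:
  fixes M :: "'a::field mat"
  assumes M: "M \<in> carrier_mat r c" and J: "J \<subseteq> {..<c}"
  shows "inj_on (col M) J \<and> module.lin_indpt class_ring (module_vec TYPE('a) r) (col M ` J) \<longleftrightarrow>
    indep_rows J {..<r} (\<lambda>k i. M $$ (i,k))"
proof -
  interpret vec_space "TYPE('a)" r .
  have finJ: "finite J" using J finite_subset by blast
  have colsJ: "col M ` J \<subseteq> carrier_vec r" using M by auto
  have lincomb: "lincomb a (col M ` J) = 0\<^sub>v r \<longleftrightarrow> (\<forall>i<r. (\<Sum>x\<in>col M ` J. a x * x $ i) = 0)" for a
    using lincomb_index[OF _ colsJ, of _ a] lincomb_dim[OF _ colsJ, of a] finJ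
    by (auto simp: vec_eq_iff)
  have "lin_indpt (col M ` J) \<longleftrightarrow> indep_rows (col M ` J) {..<r} (\<lambda>x i. x $ i)"
  proof
    assume "lin_indpt (col M ` J)"
    then show "indep_rows (col M ` J) {..<r} (\<lambda>x i. x $ i)"
      using not_lindepD[of "col M ` J" "col M ` J"] finJ lincomb
      by (fastforce simp: class_field_def intro!: indep_rowsI)
  next
    assume indep: "indep_rows (col M ` J) {..<r} (\<lambda>x i. x $ i)"
    show "lin_indpt (col M ` J)"
      using finJ colsJ lincomb indep_rowsD[OF indep]
      by (intro finite_lin_indpt2) (auto simp: class_field_def)
  qed
  also have "inj_on (col M) J \<and> \<dots> \<longleftrightarrow> indep_rows J {..<r} (\<lambda>k i. col M k $ i)"
    by (rule indep_rows_reindex[OF finJ, symmetric])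
  also have "\<dots> \<longleftrightarrow> indep_rows J {..<r} (\<lambda>k i. M $$ (i,k))"
    using M J by (intro indep_rows_cong) auto
  finally show ?thesis .
qed

lemma card_indep_cols_le_rank:
  fixes M :: "'a::field mat"
  assumes M: "M \<in> carrier_mat r c" and J: "J \<subseteq> {..<c}"
    and indep: "indep_rows J {..<r} (\<lambda>k i. M $$ (i,k))"
  shows "card J \<le> vec_space.rank r M"
proof -
  interpret vec_space "TYPE('a)" r .
  have inj: "inj_on (col M) J" and "lin_indpt (col M ` J)"
    using indep unfolding lin_indpt_cols_iff_indep_rows[OF M J, symmetric] by auto
  moreover have "col M ` J \<subseteq> set (cols M)" using M J by (auto simp: cols_def)
  ultimately show ?thesis using rank_ge_card_indpt[OF M] by (metis card_image)
qed

lemma exists_indep_cols_card_eq_rank: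
  fixes M :: "'a::field mat"
  assumes M: "M \<in> carrier_mat r c"
  obtains J where "J \<subseteq> {..<c}" "card J = vec_space.rank r M"
    and "indep_rows J {..<r} (\<lambda>k i. M $$ (i,k))"
proof -
  interpret vec_space "TYPE('a)" r .
  obtain S where S: "maximal S (\<lambda>T. T \<subseteq> set (cols M) \<and> lin_indpt T)"
    using maximal_exists_superset[of "set (cols M)" "\<lambda>T. T \<subseteq> set (cols M) \<and> lin_indpt T" "{}"]
      finite_lin_indpt2[of "{}"] by auto
  then have "S \<subseteq> col M ` {..<c}" and lin: "lin_indpt S"
    using M by (auto simp: maximal_def cols_def atLeast0LessThan)
  then obtain J where J: "J \<subseteq> {..<c}" "inj_on (col M) J" "S = col M ` J"
    using subset_image_inj[of S "col M" "{..<c}"] by blast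
  show thesis
  proof (rule that)
    show "card J = rank M" using rank_card_indpt[OF M S] J(2,3) by (simp add: card_image)
    show "indep_rows J {..<r} (\<lambda>k i. M $$ (i,k))"
      using lin_indpt_cols_iff_indep_rows[OF M J(1)] J(2,3) lin by blast
  qed (rule J(1))
qed

lemma rank_eq_dim_col_iff:
  assumes M: "M \<in> carrier_mat r c"
  shows "vec_space.rank r M = c \<longleftrightarrow> indep_rows {..<c} {..<r} (\<lambda>k i. M $$ (i,k))"
proof
  assume "vec_space.rank r M = c"
  then obtain J where J: "J \<subseteq> {..<c}" "card J = c" "indep_rows J {..<r} (\<lambda>k i. M $$ (i,k))"
    using exists_indep_cols_card_eq_rank[OF M] by metis
  then have "J = {..<c}" by (simp add: card_subset_eq)
  then show "indep_rows {..<c} {..<r} (\<lambda>k i. M $$ (i,k))" using J(3) by simp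
next
  assume "indep_rows {..<c} {..<r} (\<lambda>k i. M $$ (i,k))"
  then show "vec_space.rank r M = c"
    using card_indep_cols_le_rank[OF M order_refl] vec_space.rank_le_nc[OF M] by simp
qed

lemma rank_le_dim_row:
  assumes M: "M \<in> carrier_mat r c"
  shows "vec_space.rank r M \<le> r"
proof -
  obtain J where J: "J \<subseteq> {..<c}" "card J = vec_space.rank r M"
    "indep_rows J {..<r} (\<lambda>k i. M $$ (i,k))"
    by (rule exists_indep_cols_card_eq_rank[OF M])
  then show ?thesis using indep_rows_imp_card_le[of J "{..<r}"] finite_subset by fastforce
qed

lemma rank_eq_dim_row_iff:
  assumes M: "M \<in> carrier_mat r c"
  shows "vec_space.rank r M = r \<longleftrightarrow> indep_rows {..<r} {..<c} (\<lambda>i k. M $$ (i,k))"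
proof
  assume "vec_space.rank r M = r"
  then obtain J where J: "J \<subseteq> {..<c}" "card J = r" "indep_rows J {..<r} (\<lambda>k i. M $$ (i,k))"
    using exists_indep_cols_card_eq_rank[OF M] by metis
  have "finite J" using J(1) finite_subset by blast
  then have "indep_rows {..<r} J (\<lambda>i k. M $$ (i,k))"
    using J(2,3) by (subst indep_rows_transpose) auto
  then show "indep_rows {..<r} {..<c} (\<lambda>i k. M $$ (i,k))" using J(1) by (rule indep_rows_mono)
next
  assume "indep_rows {..<r} {..<c} (\<lambda>i k. M $$ (i,k))"
  then obtain J where J: "J \<subseteq> {..<c}" "card J = r" "indep_rows {..<r} J (\<lambda>i k. M $$ (i,k))"
    by (rule indep_rows_basis[rotated 2]) auto
  have "finite J" using J(1) finite_subset by blast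
  then have "indep_rows J {..<r} (\<lambda>k i. M $$ (i,k))"
    using J(2,3) by (subst (asm) indep_rows_transpose) auto
  then show "vec_space.rank r M = r"
    using card_indep_cols_le_rank[OF M J(1)] rank_le_dim_row[OF M] J(2) by simp
qed

section \<open>Genericity\<close>

definition multiaffine :: "'e set \<Rightarrow> (('e \<Rightarrow> real) \<Rightarrow> 'v::real_vector) \<Rightarrow> bool" where
  "multiaffine E h \<longleftrightarrow>
     (\<forall>\<theta> e. \<exists>u v. \<forall>t. h (\<theta>(e := t)) = u + t *\<^sub>R v) \<and>
     (\<forall>\<theta> \<theta>'. (\<forall>e\<in>E. \<theta> e = \<theta>' e) \<longrightarrow> h \<theta> = h \<theta>')"

definition coordinatewise_cofinite :: "'e set \<Rightarrow> ('e \<Rightarrow> real) set \<Rightarrow> bool" where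
  "coordinatewise_cofinite E G \<longleftrightarrow> (\<forall>\<theta>\<in>G. \<forall>e\<in>E. finite {t. \<theta>(e := t) \<notin> G})"

lemma multiaffine_mono:
  assumes "multiaffine E h" "E \<subseteq> E'"
  shows "multiaffine E' h"
proof -
  have "\<forall>e\<in>E. \<theta> e = \<theta>' e" if "\<forall>e\<in>E'. \<theta> e = \<theta>' e" for \<theta> \<theta>' :: "'a \<Rightarrow> real"
    using that assms(2) by auto
  then show ?thesis using assms(1) unfolding multiaffine_def by simp
qed

lemma coordinatewise_cofinite_INT:
  assumes "finite T" "\<And>t. t \<in> T \<Longrightarrow> coordinatewise_cofinite E (G t)"
  shows "coordinatewise_cofinite E (\<Inter>t\<in>T. G t)"
  unfolding coordinatewise_cofinite_def
proof (intro ballI)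
  fix \<theta> e assume "\<theta> \<in> (\<Inter>t\<in>T. G t)" "e \<in> E"
  then have "finite (\<Union>t\<in>T. {s. \<theta>(e := s) \<notin> G t})"
    using assms unfolding coordinatewise_cofinite_def by blast
  moreover have "{s. \<theta>(e := s) \<notin> (\<Inter>t\<in>T. G t)} = (\<Union>t\<in>T. {s. \<theta>(e := s) \<notin> G t})" by blast
  ultimately show "finite {s. \<theta>(e := s) \<notin> (\<Inter>t\<in>T. G t)}" by simp
qed

lemma affine_eq_0_twice:
  fixes u v :: "'v::real_vector"
  assumes "u + s *\<^sub>R v = 0" "u + t *\<^sub>R v = 0" "s \<noteq> t"
  shows "u = 0 \<and> v = 0"
proof -
  have "(s - t) *\<^sub>R v = 0"
    using assms(1,2) by (metis add_left_cancel right_minus_eq scaleR_diff_left)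
  then show ?thesis using assms by simp
qed

lemma finite_affine_eq_0:
  fixes u v :: "'v::real_vector"
  assumes "u + t *\<^sub>R v \<noteq> 0"
  shows "finite {t. u + t *\<^sub>R v = 0}"
proof (cases "\<exists>s. u + s *\<^sub>R v = 0")
  case True
  then obtain s where s: "u + s *\<^sub>R v = 0" by blast
  have "{t. u + t *\<^sub>R v = 0} \<subseteq> {s}" using affine_eq_0_twice[OF s] assms by force
  then show ?thesis by (rule finite_subset) simp
qed simp

lemma coordinatewise_cofinite_multiaffine_ne_0:
  assumes "multiaffine E h"
  shows "coordinatewise_cofinite E' {\<theta>. h \<theta> \<noteq> 0}"
  unfolding coordinatewise_cofinite_def
proof (intro ballI)
  fix \<theta> e assume \<theta>: "\<theta> \<in> {\<theta>. h \<theta> \<noteq> 0}"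
  obtain u v where affine: "\<And>t. h (\<theta>(e := t)) = u + t *\<^sub>R v"
    using assms unfolding multiaffine_def by blast
  then have "u + \<theta> e *\<^sub>R v \<noteq> 0" using \<theta> affine[of "\<theta> e"] by simp
  then show "finite {t. \<theta>(e := t) \<notin> {\<theta>. h \<theta> \<noteq> 0}}"
    using finite_affine_eq_0 by (simp add: affine)
qed

text \<open>Coordinatewise cofinite sets are Zariski dense as far as multiaffine functions can tell.\<close>

lemma multiaffine_ne_0_on_coordinatewise_cofinite:
  assumes "finite E" "multiaffine E h" "coordinatewise_cofinite E G" "\<theta> \<in> G" and ne: "h \<theta>' \<noteq> 0"
  shows "\<exists>\<theta>\<in>G. h \<theta> \<noteq> 0"
proof (rule ccontr)
  assume "\<not> ?thesis"
  then have zero: "h \<theta> = 0" if "\<theta> \<in> G" for \<theta> using that by blast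
  have "h \<theta>2 = 0" if "\<theta>1 \<in> G" "S \<subseteq> E" "\<And>e. e \<notin> S \<Longrightarrow> \<theta>2 e = \<theta>1 e" for S \<theta>1 \<theta>2
    using finite_subset[OF that(2) \<open>finite E\<close>] that
  proof (induction S arbitrary: \<theta>1 \<theta>2 rule: finite_induct)
    case empty
    then have "\<theta>2 = \<theta>1" by auto
    then show ?case using empty zero by simp
  next
    case (insert e S)
    obtain u v where affine: "\<And>t. h (\<theta>2(e := t)) = u + t *\<^sub>R v"
      using \<open>multiaffine E h\<close> unfolding multiaffine_def by blast
    have vanishes: "u + t *\<^sub>R v = 0" if "\<theta>1(e := t) \<in> G" for t
    proof -
      have "(\<theta>2(e := t)) e' = (\<theta>1(e := t)) e'" if "e' \<notin> S" for e'
        using insert.prems(3)[of e'] that by simp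
      then have "h (\<theta>2(e := t)) = 0" using insert.prems(2) by (intro insert.IH[OF that]) auto
      then show ?thesis by (simp add: affine)
    qed
    have fin: "finite {t. \<theta>1(e := t) \<notin> G}"
      using \<open>coordinatewise_cofinite E G\<close> insert.prems by (auto simp: coordinatewise_cofinite_def)
    obtain s where s: "\<theta>1(e := s) \<in> G"
      using ex_new_if_finite[OF infinite_UNIV_char_0 fin] by blast
    obtain t where t: "\<theta>1(e := t) \<in> G" "t \<noteq> s"
      using ex_new_if_finite[OF infinite_UNIV_char_0, of "insert s {t. \<theta>1(e := t) \<notin> G}"] fin
      by blast
    have "u = 0 \<and> v = 0" using affine_eq_0_twice[OF vanishes[OF s] vanishes[OF t(1)]] t(2) by blast
    then show ?case using affine[of "\<theta>2 e"] by simp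
  qed
  from this[OF \<open>\<theta> \<in> G\<close> order_refl, of "\<lambda>e. if e \<in> E then \<theta>' e else \<theta> e"]
  have "h (\<lambda>e. if e \<in> E then \<theta>' e else \<theta> e) = 0" by simp
  moreover have "h (\<lambda>e. if e \<in> E then \<theta>' e else \<theta> e) = h \<theta>'"
    using \<open>multiaffine E h\<close> unfolding multiaffine_def by simp
  ultimately show False using ne by simp
qed

lemma det_replace_column:
  fixes h :: "nat \<Rightarrow> nat \<Rightarrow> 'a::comm_ring_1"
  assumes "s < n"
  shows "det (mat n n (\<lambda>(a,b). if b = s then u a else h a b)) =
    (\<Sum>a<n. u a * cofactor (mat n n (\<lambda>(a,b). h a b)) a s)"
proof -
  let ?M = "mat n n (\<lambda>(a,b). if b = s then u a else h a b)"
  have "det ?M = (\<Sum>a<n. ?M $$ (a,s) * cofactor ?M a s)"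
    by (rule laplace_expansion_column[OF _ assms]) simp
  also have "\<dots> = (\<Sum>a<n. u a * cofactor (mat n n (\<lambda>(a,b). h a b)) a s)"
  proof (rule sum.cong[OF refl])
    fix a assume "a \<in> {..<n}"
    then have "mat_delete ?M a s = mat_delete (mat n n (\<lambda>(a,b). h a b)) a s"
      unfolding mat_delete_def using assms by (intro eq_matI) auto
    then show "?M $$ (a,s) * cofactor ?M a s = u a * cofactor (mat n n (\<lambda>(a,b). h a b)) a s"
      using assms \<open>a \<in> {..<n}\<close> by (simp add: cofactor_def)
  qed
  finally show ?thesis .
qed

section \<open>Matrix pencils with free entries\<close>

definition free_pencil ::
  "('i \<Rightarrow> 'k \<Rightarrow> complex poly) \<Rightarrow> ('i \<times> 'k) set \<Rightarrow> ('i \<times> 'k \<Rightarrow> real) \<Rightarrow> complex \<Rightarrow> 'i \<Rightarrow> 'k \<Rightarrow> complex" where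
  "free_pencil P S \<theta> \<mu> i k = poly (P i k) \<mu> + (if (i,k) \<in> S then of_real (\<theta> (i,k)) else 0)"

lemma free_pencil_zero: "free_pencil P S (\<lambda>_. 0) \<mu> i k = poly (P i k) \<mu>"
  by (simp add: free_pencil_def)

lemma multiaffine_free_pencil_minor:
  assumes r: "inj_on r {..<p}" and f: "inj_on f {..<p}"
  shows "multiaffine (r ` {..<p} \<times> f ` {..<p})
    (\<lambda>\<theta>. det (mat p p (\<lambda>(a,b). free_pencil P S \<theta> \<mu> (r a) (f b))))"
    (is "multiaffine ?E ?D")
  unfolding multiaffine_def
proof (intro conjI allI impI)
  show local: "?D \<theta> = ?D \<theta>'" if "\<forall>e\<in>?E. \<theta> e = \<theta>' e" for \<theta> \<theta>'
    using that by (intro arg_cong[of _ _ det] cong_mat) (auto simp: free_pencil_def)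
  fix \<theta> :: "'a \<times> 'b \<Rightarrow> real" and e
  show "\<exists>u v. \<forall>t. ?D (\<theta>(e := t)) = u + t *\<^sub>R v"
  proof (cases "e \<in> ?E")
    case False
    then have "?D (\<theta>(e := t)) = ?D \<theta> + t *\<^sub>R 0" for t by (auto intro!: local)
    then show ?thesis by blast
  next
    case True
    then obtain c s where c: "c < p" and s: "s < p" and e: "e = (r c, f s)" by auto
    let ?h = "\<lambda>t a b. free_pencil P S (\<theta>(e := t)) \<mu> (r a) (f b)"
    define C where "C a = cofactor (mat p p (\<lambda>(a,b). ?h 0 a b)) a s" for a
    have "?D (\<theta>(e := t)) = (\<Sum>a<p. ?h 0 a s * C a) + t *\<^sub>R (of_bool ((r c, f s) \<in> S) * C c)" for t
    proof -
      have "mat p p (\<lambda>(a,b). ?h t a b) = mat p p (\<lambda>(a,b). if b = s then ?h t a s else ?h 0 a b)"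
        using s f by (intro cong_mat) (auto simp: free_pencil_def e inj_on_def)
      then have "?D (\<theta>(e := t)) = (\<Sum>a<p. ?h t a s * C a)"
        unfolding C_def by (simp only: det_replace_column[OF s])
      also have "\<dots> = (\<Sum>a<p. ?h 0 a s * C a +
          (if a = c then of_real t * (of_bool ((r c, f s) \<in> S) * C c) else 0))"
        using c r by (intro sum.cong) (auto simp: free_pencil_def e inj_on_def algebra_simps)
      finally show ?thesis using c by (simp add: sum.distrib scaleR_conv_of_real)
    qed
    then show ?thesis by blast
  qed
qed

lemma indep_free_pencil_imp_minor:
  fixes \<theta> :: "'i \<times> 'k \<Rightarrow> real"
  assumes "finite I" "finite K" "indep_rows I K (free_pencil P S \<theta> \<mu>)"
  obtains D :: "('i \<times> 'k \<Rightarrow> real) \<Rightarrow> complex" where "multiaffine (I \<times> K) D" "D \<theta> \<noteq> 0"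
    and "\<forall>\<theta>. D \<theta> \<noteq> 0 \<longrightarrow> indep_rows I K (free_pencil P S \<theta> \<mu>)"
proof -
  obtain r where r: "bij_betw r {..<card I} I"
    using assms(1) ex_bij_betw_nat_finite atLeast0LessThan by metis
  obtain f where f: "inj_on f {..<card I}" "f ` {..<card I} \<subseteq> K"
    and minor: "det (mat (card I) (card I) (\<lambda>(a,b). free_pencil P S \<theta> \<mu> (r a) (f b))) \<noteq> 0"
    using assms(3) unfolding indep_rows_iff_minor[OF r assms(2)] by blast
  let ?D = "\<lambda>\<theta>. det (mat (card I) (card I) (\<lambda>(a,b). free_pencil P S \<theta> \<mu> (r a) (f b)))"
  have "multiaffine (r ` {..<card I} \<times> f ` {..<card I}) ?D"
    using r f(1) by (intro multiaffine_free_pencil_minor) (auto simp: bij_betw_def)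
  then have multiaffine: "multiaffine (I \<times> K) ?D"
    by (rule multiaffine_mono) (use r f(2) in \<open>auto simp: bij_betw_def\<close>)
  show thesis
  proof (rule that[OF multiaffine])
    show "?D \<theta> \<noteq> 0" by (rule minor)
    show "\<forall>\<theta>. ?D \<theta> \<noteq> 0 \<longrightarrow> indep_rows I K (free_pencil P S \<theta> \<mu>)"
      unfolding indep_rows_iff_minor[OF r assms(2)] using f by blast
  qed
qed

lemma coordinatewise_cofinite_indep_free_pencil:
  assumes "finite I" "finite K"
  shows "coordinatewise_cofinite E {\<theta>. indep_rows I K (free_pencil P S \<theta> \<mu>)}"
  unfolding coordinatewise_cofinite_def
proof (intro ballI)
  fix \<theta> e assume "\<theta> \<in> {\<theta>. indep_rows I K (free_pencil P S \<theta> \<mu>)}" and e: "e \<in> E"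
  then have "indep_rows I K (free_pencil P S \<theta> \<mu>)" by simp
  then obtain D :: "_ \<Rightarrow> complex" where D: "multiaffine (I \<times> K) D" "D \<theta> \<noteq> 0"
    and indep: "\<forall>\<theta>. D \<theta> \<noteq> 0 \<longrightarrow> indep_rows I K (free_pencil P S \<theta> \<mu>)"
    by (rule indep_free_pencil_imp_minor[OF assms])
  have "finite {t. \<theta>(e := t) \<notin> {\<theta>. D \<theta> \<noteq> 0}}"
    using coordinatewise_cofinite_multiaffine_ne_0[OF D(1), of E] D(2) e
    unfolding coordinatewise_cofinite_def by blast
  then show "finite {t. \<theta>(e := t) \<notin> {\<theta>. indep_rows I K (free_pencil P S \<theta> \<mu>)}}"
    by (rule finite_subset[rotated]) (use indep in blast)
qed

lemma indep_free_pencil_on_coordinatewise_cofinite: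
  assumes "finite I" "finite K" "coordinatewise_cofinite (I \<times> K) G" "\<theta> \<in> G"
    and "indep_rows I K (free_pencil P S \<theta>' \<mu>)"
  shows "\<exists>\<theta>\<in>G. indep_rows I K (free_pencil P S \<theta> \<mu>)"
proof -
  obtain D :: "_ \<Rightarrow> complex" where D: "multiaffine (I \<times> K) D" "D \<theta>' \<noteq> 0"
    and indep: "\<forall>\<theta>. D \<theta> \<noteq> 0 \<longrightarrow> indep_rows I K (free_pencil P S \<theta> \<mu>)"
    by (rule indep_free_pencil_imp_minor[OF assms(1,2,5)])
  have "\<exists>\<theta>\<in>G. D \<theta> \<noteq> 0"
    using multiaffine_ne_0_on_coordinatewise_cofinite[OF _ D(1) assms(3,4) D(2)] assms(1,2) by simp
  then show ?thesis using indep by blast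
qed

lemma coordinatewise_cofinite_common_indep_free_pencil:
  assumes "finite T" "\<And>t. t \<in> T \<Longrightarrow> finite (I t) \<and> finite (K t)"
  shows "coordinatewise_cofinite E
    {\<theta>. \<forall>t\<in>T. indep_rows (I t) (K t) (free_pencil P S \<theta> (\<mu> t))}"
proof -
  have "coordinatewise_cofinite E (\<Inter>t\<in>T. {\<theta>. indep_rows (I t) (K t) (free_pencil P S \<theta> (\<mu> t))})"
    using assms
    by (intro coordinatewise_cofinite_INT coordinatewise_cofinite_indep_free_pencil) auto
  then show ?thesis by (simp add: INTER_eq)
qed

lemma exists_common_indep_free_pencil:
  assumes "finite T" "\<And>t. t \<in> T \<Longrightarrow> finite (I t) \<and> finite (K t)"
    and "\<And>t. t \<in> T \<Longrightarrow> \<exists>\<theta>. indep_rows (I t) (K t) (free_pencil P S \<theta> (\<mu> t))"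
  shows "\<exists>\<theta>. \<forall>t\<in>T. indep_rows (I t) (K t) (free_pencil P S \<theta> (\<mu> t))"
  using assms
proof (induction T rule: finite_induct)
  case (insert t T)
  let ?G = "{\<theta>. \<forall>t\<in>T. indep_rows (I t) (K t) (free_pencil P S \<theta> (\<mu> t))}"
  have "\<exists>\<theta>. \<forall>t\<in>T. indep_rows (I t) (K t) (free_pencil P S \<theta> (\<mu> t))"
    using insert.prems by (intro insert.IH) simp_all
  then obtain \<theta> where \<theta>: "\<theta> \<in> ?G" by auto
  obtain \<theta>' where \<theta>': "indep_rows (I t) (K t) (free_pencil P S \<theta>' (\<mu> t))"
    using insert.prems(2)[of t] by auto
  have "finite (I t)" "finite (K t)" using insert.prems(1)[of t] by simp_all
  moreover have "coordinatewise_cofinite (I t \<times> K t) ?G"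
    using insert.hyps(1) insert.prems(1)
    by (intro coordinatewise_cofinite_common_indep_free_pencil) simp_all
  ultimately have "\<exists>\<theta>\<in>?G. indep_rows (I t) (K t) (free_pencil P S \<theta> (\<mu> t))"
    using \<theta> \<theta>' by (rule indep_free_pencil_on_coordinatewise_cofinite)
  then show ?case by auto
qed simp

lemma finite_dependent_poly_matrix:
  fixes Q :: "'i \<Rightarrow> 'k \<Rightarrow> 'a::field poly"
  assumes "finite I" "finite K" "indep_rows I K (\<lambda>i k. poly (Q i k) \<mu>)"
  shows "finite {\<mu>. \<not> indep_rows I K (\<lambda>i k. poly (Q i k) \<mu>)}"
proof -
  obtain r where r: "bij_betw r {..<card I} I"
    using assms(1) ex_bij_betw_nat_finite atLeast0LessThan by metis
  obtain f where f: "inj_on f {..<card I}" "f ` {..<card I} \<subseteq> K"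
    and minor: "det (mat (card I) (card I) (\<lambda>(a,b). poly (Q (r a) (f b)) \<mu>)) \<noteq> 0"
    using assms(3) unfolding indep_rows_iff_minor[OF r assms(2)] by blast
  define D where "D = det (mat (card I) (card I) (\<lambda>(a,b). Q (r a) (f b)))"
  have D: "poly D \<mu> = det (mat (card I) (card I) (\<lambda>(a,b). poly (Q (r a) (f b)) \<mu>))" for \<mu>
    unfolding D_def by (rule poly_det_cong) auto
  have "D \<noteq> 0" using minor unfolding D[symmetric] by auto
  then have "finite {\<mu>. poly D \<mu> = 0}" by (rule poly_roots_finite)
  moreover have "indep_rows I K (\<lambda>i k. poly (Q i k) \<mu>)" if "poly D \<mu> \<noteq> 0" for \<mu>
    unfolding indep_rows_iff_minor[OF r assms(2)] using f that D by metis
  ultimately show ?thesis by (elim finite_subset[rotated]) auto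
qed

definition singular_points ::
  "'i set \<Rightarrow> 'k set \<Rightarrow> ('i \<Rightarrow> 'k \<Rightarrow> complex poly) \<Rightarrow> ('i \<times> 'k) set \<Rightarrow> ('i \<times> 'k \<Rightarrow> real) \<Rightarrow>
    complex set" where
  "singular_points I K P S \<theta> = {\<mu>. \<not> indep_rows I K (free_pencil P S \<theta> \<mu>)}"

lemma finite_singular_points:
  assumes "finite I" "finite K" "indep_rows I K (free_pencil P S \<theta> \<mu>)"
  shows "finite (singular_points I K P S \<theta>)"
proof -
  define Q where "Q i k = P i k + (if (i,k) \<in> S then [:of_real (\<theta> (i,k)):] else 0)" for i k
  have "free_pencil P S \<theta> \<mu> = (\<lambda>i k. poly (Q i k) \<mu>)" for \<mu>
    by (auto simp: free_pencil_def Q_def fun_eq_iff)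
  then show ?thesis
    unfolding singular_points_def
    using finite_dependent_poly_matrix[OF assms(1,2), of Q \<mu>] assms(3) by simp
qed

lemma common_point_indep_free_pencil:
  assumes "finite I" "finite K" "indep_rows I K (free_pencil P S \<theta>1 \<mu>1)"
    and "finite I'" "finite K'" "indep_rows I' K' (free_pencil P S \<theta>2 \<mu>2)"
  obtains \<theta> \<mu> where "indep_rows I K (free_pencil P S \<theta> \<mu>)" "indep_rows I' K' (free_pencil P S \<theta> \<mu>)"
proof -
  obtain \<theta> where "indep_rows I K (free_pencil P S \<theta> \<mu>1)" "indep_rows I' K' (free_pencil P S \<theta> \<mu>2)"
    using indep_free_pencil_on_coordinatewise_cofinite[OF assms(4,5)
        coordinatewise_cofinite_indep_free_pencil[OF assms(1,2)] _ assms(6), of \<theta>1 P S \<mu>1] assms(3)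
    by auto
  then have "finite (singular_points I K P S \<theta> \<union> singular_points I' K' P S \<theta>)"
    using assms finite_singular_points by blast
  then obtain \<mu> where "\<mu> \<notin> singular_points I K P S \<theta> \<union> singular_points I' K' P S \<theta>"
    using ex_new_if_finite[OF infinite_UNIV_char_0] by blast
  then show thesis using that unfolding singular_points_def by blast
qed

text \<open>As \<open>\<theta> (i,k)\<close> moves, the singular points stay in the finite set of singular points of the
  columns other than \<open>k\<close>, and each of these is singular either always or for finitely many values.\<close>

lemma finite_singular_points_change:
  assumes "finite I" "finite K" and avoid: "indep_rows I (K - {k}) (free_pencil P S \<theta> \<mu>)"
    and "finite B"
    and minimal: "\<And>t. t \<notin> B \<Longrightarrow>
      card (singular_points I K P S \<theta>) \<le> card (singular_points I K P S (\<theta>((i,k) := t)))"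
  shows "finite {t. singular_points I K P S (\<theta>((i,k) := t)) \<noteq> singular_points I K P S \<theta>}"
proof -
  let ?Z = "singular_points I K P S" and ?\<theta> = "\<lambda>t. \<theta>((i,k) := t)"
  define Y where "Y = singular_points I (K - {k}) P S \<theta>"
  have "finite Y" unfolding Y_def using assms(1,2) avoid by (intro finite_singular_points) auto
  have Z_subset: "?Z (?\<theta> t) \<subseteq> Y" for t
  proof -
    have "indep_rows I (K - {k}) (free_pencil P S (?\<theta> t) \<mu>) \<longleftrightarrow>
        indep_rows I (K - {k}) (free_pencil P S \<theta> \<mu>)" for \<mu>
      by (rule indep_rows_cong) (auto simp: free_pencil_def)
    then show ?thesis
      using indep_rows_mono[of I "K - {k}" "free_pencil P S (?\<theta> t) _" K]
      unfolding Y_def singular_points_def by auto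
  qed
  have finite_Z: "finite (?Z \<theta>)"
    using finite_subset[OF Z_subset[of "\<theta> (i,k)"] \<open>finite Y\<close>] by simp
  define entering where "entering \<mu> = {t. \<mu> \<notin> ?Z \<theta> \<and> \<mu> \<in> ?Z (?\<theta> t)}" for \<mu>
  have "finite (entering \<mu>)" for \<mu>
    using coordinatewise_cofinite_indep_free_pencil[OF assms(1,2), of UNIV P S \<mu>]
    unfolding entering_def coordinatewise_cofinite_def singular_points_def by simp
  then have "finite (B \<union> (\<Union>\<mu>\<in>Y. entering \<mu>))" using \<open>finite Y\<close> \<open>finite B\<close> by blast
  moreover have "?Z (?\<theta> t) = ?Z \<theta>" if t: "t \<notin> B \<union> (\<Union>\<mu>\<in>Y. entering \<mu>)" for t
  proof (rule card_seteq[OF finite_Z])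
    show "?Z (?\<theta> t) \<subseteq> ?Z \<theta>" using t Z_subset[of t] unfolding entering_def by auto
    show "card (?Z \<theta>) \<le> card (?Z (?\<theta> t))" using minimal t by blast
  qed
  ultimately show ?thesis by (elim finite_subset[rotated]) blast
qed

lemma coordinatewise_cofinite_minimal_singular_points:
  assumes "finite I" "finite K" and R: "coordinatewise_cofinite (I \<times> K) R"
    and avoid: "\<And>\<theta> k. \<theta> \<in> R \<Longrightarrow> k \<in> K \<Longrightarrow> \<exists>\<mu>. indep_rows I (K - {k}) (free_pencil P S \<theta> \<mu>)"
    and minimal: "\<And>\<theta>. \<theta> \<in> R \<Longrightarrow> card (singular_points I K P S \<theta>0) \<le> card (singular_points I K P S \<theta>)"
  shows "coordinatewise_cofinite (I \<times> K)
    {\<theta> \<in> R. singular_points I K P S \<theta> = singular_points I K P S \<theta>0}"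
    (is "coordinatewise_cofinite _ {\<theta> \<in> R. ?Z \<theta> = _}")
  unfolding coordinatewise_cofinite_def
proof (intro ballI)
  fix \<theta> e assume "\<theta> \<in> {\<theta> \<in> R. ?Z \<theta> = ?Z \<theta>0}" and e: "e \<in> I \<times> K"
  then have \<theta>: "\<theta> \<in> R" "?Z \<theta> = ?Z \<theta>0" by auto
  obtain i k where ik: "e = (i,k)" "k \<in> K" using e by blast
  obtain \<mu> where \<mu>: "indep_rows I (K - {k}) (free_pencil P S \<theta> \<mu>)"
    using avoid[OF \<theta>(1) ik(2)] by blast
  let ?B = "{t. \<theta>(e := t) \<notin> R}"
  have "finite ?B" using R \<theta>(1) e unfolding coordinatewise_cofinite_def by blast
  moreover from this have "finite {t. ?Z (\<theta>(e := t)) \<noteq> ?Z \<theta>}"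
    unfolding ik(1)
    by (rule finite_singular_points_change[OF assms(1,2) \<mu>]) (use minimal \<theta>(2) in auto)
  ultimately have "finite (?B \<union> {t. ?Z (\<theta>(e := t)) \<noteq> ?Z \<theta>})" by simp
  then show "finite {t. \<theta>(e := t) \<notin> {\<theta> \<in> R. ?Z \<theta> = ?Z \<theta>0}}"
    by (rule finite_subset[rotated]) (use \<theta>(2) in auto)
qed

theorem generic_indep_rows:
  assumes "finite I" "finite K"
    and avoid: "\<And>k. k \<in> K \<Longrightarrow> \<exists>\<theta> \<mu>. indep_rows I (K - {k}) (free_pencil P S \<theta> \<mu>)"
    and pointwise: "\<And>\<mu>. \<exists>\<theta>. indep_rows I K (free_pencil P S \<theta> \<mu>)"
  shows "\<exists>\<theta>. \<forall>\<mu>. indep_rows I K (free_pencil P S \<theta> \<mu>)"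
proof -
  let ?Z = "singular_points I K P S"
  obtain \<nu> where \<nu>: "\<And>k. k \<in> K \<Longrightarrow> \<exists>\<theta>. indep_rows I (K - {k}) (free_pencil P S \<theta> (\<nu> k))"
    using avoid by metis
  define R where "R = {\<theta>. \<forall>k\<in>K. indep_rows I (K - {k}) (free_pencil P S \<theta> (\<nu> k))}"
  have "\<exists>\<theta>. \<theta> \<in> R"
    using exists_common_indep_free_pencil[of K "\<lambda>_. I" "\<lambda>k. K - {k}" P S \<nu>] \<nu> assms(1,2)
    unfolding R_def by simp
  then obtain \<theta>0 where "\<theta>0 \<in> R" and minimal: "\<And>\<theta>. \<theta> \<in> R \<Longrightarrow> card (?Z \<theta>0) \<le> card (?Z \<theta>)"
    using ex_has_least_nat[of "\<lambda>\<theta>. \<theta> \<in> R" _ "\<lambda>\<theta>. card (?Z \<theta>)"] by blast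
  have "coordinatewise_cofinite (I \<times> K) R"
    unfolding R_def
    by (rule coordinatewise_cofinite_common_indep_free_pencil) (use assms(1,2) in auto)
  then have cofinite: "coordinatewise_cofinite (I \<times> K) {\<theta> \<in> R. ?Z \<theta> = ?Z \<theta>0}"
    by (rule coordinatewise_cofinite_minimal_singular_points[OF assms(1,2)])
       (use minimal in \<open>auto simp: R_def\<close>)
  have "\<mu> \<notin> ?Z \<theta>0" for \<mu>
  proof -
    obtain \<theta> where "indep_rows I K (free_pencil P S \<theta> \<mu>)" using pointwise by blast
    then show ?thesis
      using indep_free_pencil_on_coordinatewise_cofinite[OF assms(1,2) cofinite, of \<theta>0] \<open>\<theta>0 \<in> R\<close>
      unfolding singular_points_def by blast
  qed
  then show ?thesis unfolding singular_points_def by blast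
qed

lemma left_kernel_proportional:
  fixes h :: "'i \<Rightarrow> 'k \<Rightarrow> 'a::field"
  assumes "indep_rows I (K - {i}) h"
    and q0: "\<And>k. k \<in> K - {i,l} \<Longrightarrow> (\<Sum>a\<in>I. q0 a * h a k) = 0" "\<exists>a\<in>I. q0 a \<noteq> 0"
    and q: "\<And>k. k \<in> K - {i,l} \<Longrightarrow> (\<Sum>a\<in>I. q a * h a k) = 0"
  obtains s where "\<forall>a\<in>I. q a = s * q0 a"
proof -
  define c where "c = (\<Sum>a\<in>I. q0 a * h a l)"
  have "c \<noteq> 0"
  proof
    assume "c = 0"
    then have "(\<Sum>a\<in>I. q0 a * h a k) = 0" if "k \<in> K - {i}" for k
      using q0(1)[of k] that by (cases "k = l") (auto simp: c_def)
    then show False using indep_rowsD[OF assms(1), of q0] q0(2) by blast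
  qed
  define s where "s = (\<Sum>a\<in>I. q a * h a l) / c"
  have "(\<Sum>a\<in>I. (q a - s * q0 a) * h a k) = (\<Sum>a\<in>I. q a * h a k) - s * (\<Sum>a\<in>I. q0 a * h a k)" for k
    by (simp add: left_diff_distrib sum_subtractf sum_distrib_left mult.assoc)
  then have "(\<Sum>a\<in>I. (q a - s * q0 a) * h a k) = 0" if "k \<in> K - {i}" for k
    using q[of k] q0(1)[of k] that \<open>c \<noteq> 0\<close> by (cases "k = l") (auto simp: s_def c_def)
  then have "q a - s * q0 a = 0" if "a \<in> I" for a
    using indep_rowsD[OF assms(1), of "\<lambda>a. q a - s * q0 a" a] that by simp
  then show thesis using that[of s] by simp
qed

lemma indep_rows_perturb_entry:
  fixes h :: "'i \<Rightarrow> 'k \<Rightarrow> 'a::field"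
  assumes "finite I" and i: "i \<in> K" "i \<noteq> l" and j: "j \<in> I" and "c \<noteq> 0"
    and avoid_i: "indep_rows I (K - {i}) h"
    and delete_j: "indep_rows (I - {j}) (K - {l}) h"
  shows "indep_rows I (K - {l}) h \<or>
    indep_rows I (K - {l}) (\<lambda>a k. h a k + (if a = j \<and> k = i then c else 0))"
    (is "_ \<or> indep_rows I (K - {l}) ?h")
proof (cases "indep_rows I (K - {l}) h")
  case False
  then obtain q0 a0 where q0: "\<And>k. k \<in> K - {l} \<Longrightarrow> (\<Sum>a\<in>I. q0 a * h a k) = 0"
    and a0: "a0 \<in> I" "q0 a0 \<noteq> 0"
    unfolding indep_rows_def by blast
  have q0j: "q0 j \<noteq> 0"
  proof
    assume "q0 j = 0"
    then have "(\<Sum>a\<in>I - {j}. q0 a * h a k) = 0" if "k \<in> K - {l}" for k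
      using q0[OF that] sum.remove[OF \<open>finite I\<close> j, of "\<lambda>a. q0 a * h a k"] by simp
    then show False using indep_rowsD[OF delete_j, of q0 a0] a0 \<open>q0 j = 0\<close> by auto
  qed
  have "indep_rows I (K - {l}) ?h"
  proof (rule indep_rowsI)
    fix q a assume kernel: "\<And>k. k \<in> K - {l} \<Longrightarrow> (\<Sum>a\<in>I. q a * ?h a k) = 0" and a: "a \<in> I"
    have "(\<Sum>a\<in>I. q a * ?h a k) = (\<Sum>a\<in>I. q a * h a k) + (if k = i then q j * c else 0)" for k
      using \<open>finite I\<close> j
      by (simp add: distrib_left sum.distrib if_distrib[of "(*) _"] sum.delta cong: if_cong)
    then have q: "(\<Sum>a\<in>I. q a * h a k) + (if k = i then q j * c else 0) = 0" if "k \<in> K - {l}" for k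
      using kernel[OF that] by simp
    obtain s where s: "\<forall>a\<in>I. q a = s * q0 a"
    proof (rule left_kernel_proportional[OF avoid_i])
      show "(\<Sum>a\<in>I. q0 a * h a k) = 0" "(\<Sum>a\<in>I. q a * h a k) = 0" if "k \<in> K - {i,l}" for k
        using q0[of k] q[of k] that by auto
    qed (use a0 in auto)
    then have "(\<Sum>a\<in>I. q a * h a i) = s * (\<Sum>a\<in>I. q0 a * h a i)"
      by (simp add: sum_distrib_left mult.assoc)
    then have "s * q0 j * c = 0" using q[of i] q0[of i] i s j by simp
    then show "q a = 0" using q0j \<open>c \<noteq> 0\<close> s a by simp
  qed
  then show ?thesis ..
qed simp

lemma free_pencil_avoids_column:
  assumes "finite I" "finite K" and i: "i \<in> K" "(j,i) \<in> S" and j: "j \<in> I"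
    and avoid_i: "indep_rows I (K - {i}) (free_pencil P S \<theta>1 \<mu>1)"
    and delete_j: "indep_rows (I - {j}) (K - {l}) (free_pencil P S \<theta>2 \<mu>2)"
  shows "\<exists>\<theta> \<mu>. indep_rows I (K - {l}) (free_pencil P S \<theta> \<mu>)"
proof (cases "i = l")
  case True
  then show ?thesis using avoid_i by blast
next
  case False
  obtain \<theta> \<mu> where "indep_rows I (K - {i}) (free_pencil P S \<theta> \<mu>)"
    and "indep_rows (I - {j}) (K - {l}) (free_pencil P S \<theta> \<mu>)"
    by (rule common_point_indep_free_pencil[OF _ _ avoid_i _ _ delete_j]) (use assms(1,2) in auto)
  then have "indep_rows I (K - {l}) (free_pencil P S \<theta> \<mu>) \<or> indep_rows I (K - {l})
      (\<lambda>a k. free_pencil P S \<theta> \<mu> a k + (if a = j \<and> k = i then 1 else 0))"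
    by (intro indep_rows_perturb_entry) (use assms(1) i j False in auto)
  moreover have "(\<lambda>a k. free_pencil P S \<theta> \<mu> a k + (if a = j \<and> k = i then 1 else 0)) =
      free_pencil P S (\<theta>((j,i) := \<theta> (j,i) + 1)) \<mu>"
    using i(2) by (auto simp: free_pencil_def fun_eq_iff)
  ultimately show ?thesis by metis
qed

section \<open>The Popov--Belevitch--Hautus test\<close>

lemma cmat_carrier [simp]: "cmat M \<in> carrier_mat r c \<longleftrightarrow> M \<in> carrier_mat r c"
  by (simp add: cmat_def)

lemma cmat_dim [simp]: "dim_row (cmat M) = dim_row M" "dim_col (cmat M) = dim_col M"
  by (simp_all add: cmat_def)

lemma cmat_index [simp]: "i < dim_row M \<Longrightarrow> j < dim_col M \<Longrightarrow> cmat M $$ (i,j) = of_real (M $$ (i,j))"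
  by (simp add: cmat_def)

lemma cmat_one [simp]: "cmat (1\<^sub>m n) = 1\<^sub>m n"
  unfolding cmat_def by (rule of_real_hom.mat_hom_one)

lemma cmat_add: "M \<in> carrier_mat r c \<Longrightarrow> N \<in> carrier_mat r c \<Longrightarrow> cmat (M + N) = cmat M + cmat N"
  by (rule eq_matI) auto

lemma pow_mat_Suc_left:
  assumes "F \<in> carrier_mat n n"
  shows "F ^\<^sub>m Suc k = F * F ^\<^sub>m k"
proof (induction k)
  case (Suc k)
  have "F ^\<^sub>m Suc (Suc k) = (F * F ^\<^sub>m k) * F" using Suc.IH by simp
  also have "\<dots> = F * (F ^\<^sub>m k * F)" by (rule assoc_mult_mat) (use assms in auto)
  finally show ?case by simp
qed (use assms in simp)

lemma cmat_pow_mult: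
  assumes "F \<in> carrier_mat n n" "G \<in> carrier_mat n m"
  shows "cmat (F ^\<^sub>m k * G) = cmat F ^\<^sub>m k * cmat G"
  unfolding cmat_def of_real_hom.mat_hom_mult[OF pow_carrier_mat[OF assms(1)] assms(2)]
    of_real_hom.mat_hom_pow[OF assms(1)] ..

definition row_times :: "(nat \<Rightarrow> 'a::comm_ring_1) \<Rightarrow> 'a mat \<Rightarrow> nat \<Rightarrow> 'a" where
  "row_times q M j = (\<Sum>a<dim_row M. q a * M $$ (a,j))"

lemma row_times_mult:
  assumes "F \<in> carrier_mat n p" "M \<in> carrier_mat p m" "j < m"
  shows "row_times q (F * M) j = row_times (row_times q F) M j"
proof -
  have "row_times q (F * M) j = (\<Sum>a<n. \<Sum>b<p. q a * F $$ (a,b) * M $$ (b,j))"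
    using assms
    by (simp add: row_times_def scalar_prod_def sum_distrib_left atLeast0LessThan mult.assoc)
  also have "\<dots> = (\<Sum>b<p. (\<Sum>a<n. q a * F $$ (a,b)) * M $$ (b,j))"
    unfolding sum_distrib_right by (rule sum.swap)
  finally show ?thesis using assms by (simp add: row_times_def)
qed

lemma row_times_one [simp]: "j < n \<Longrightarrow> row_times q (1\<^sub>m n) j = q j"
  by (simp add: row_times_def if_distrib[of "(*) _"] sum.delta cong: if_cong)

lemma row_times_cong: "(\<And>a. a < dim_row M \<Longrightarrow> q a = q' a) \<Longrightarrow> row_times q M j = row_times q' M j"
  by (simp add: row_times_def)

lemma row_times_scale: "row_times (\<lambda>a. c * q a) M j = c * row_times q M j"
  by (simp add: row_times_def sum_distrib_left mult.assoc)

lemma row_times_add_mat: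
  assumes "M \<in> carrier_mat n p" "N \<in> carrier_mat n p" "j < p"
  shows "row_times q (M + N) j = row_times q M j + row_times q N j"
  using assms by (simp add: row_times_def distrib_left sum.distrib)

lemma row_times_add: "row_times (\<lambda>a. q a + q' a) M j = row_times q M j + row_times q' M j"
  by (simp add: row_times_def distrib_right sum.distrib)

lemma row_times_sum: "row_times (\<lambda>a. \<Sum>k\<in>K. c k * w k a) M j = (\<Sum>k\<in>K. c k * row_times (w k) M j)"
  unfolding row_times_def sum_distrib_left sum_distrib_right
  by (subst sum.swap) (simp add: mult.assoc)

lemma mult_add_less_mult:
  fixes k j n m :: nat
  assumes "k < n" "j < m"
  shows "k * m + j < n * m"
proof -
  have "k * m + j < Suc k * m" using assms(2) by simp
  also have "\<dots> \<le> n * m" using assms(1) by (intro mult_le_mono) auto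
  finally show ?thesis .
qed

lemma image_mult_add_lessThan: "(\<lambda>(k,j). k * m + j) ` ({..<n} \<times> {..<m}) = {..<n * m :: nat}"
proof
  show "{..<n * m} \<subseteq> (\<lambda>(k,j). k * m + j) ` ({..<n} \<times> {..<m})"
  proof
    fix l assume l: "l \<in> {..<n * m}"
    then have "0 < m" by (cases m) auto
    then have "(l div m, l mod m) \<in> {..<n} \<times> {..<m}" using l by (simp add: less_mult_imp_div_less)
    then show "l \<in> (\<lambda>(k,j). k * m + j) ` ({..<n} \<times> {..<m})" by (rule rev_image_eqI) simp
  qed
qed (use mult_add_less_mult in auto)

lemma controllable_iff_annihilator:
  assumes F: "F \<in> carrier_mat n n" and G: "G \<in> carrier_mat n m"
  shows "controllable F G \<longleftrightarrow>
    (\<forall>q. (\<forall>k<n. \<forall>j<m. row_times q (cmat F ^\<^sub>m k * cmat G) j = 0) \<longrightarrow> (\<forall>a<n. q a = 0))"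
proof -
  have C: "ctrb_mat F G \<in> carrier_mat n (n * m)" using F G by (simp add: ctrb_mat_def)
  have "controllable F G \<longleftrightarrow>
      indep_rows {..<n} {..<n * m} (\<lambda>a l. complex_of_real (ctrb_mat F G $$ (a,l)))"
    unfolding controllable_def indep_rows_complex_of_real using F rank_eq_dim_row_iff[OF C] by simp
  also have "\<dots> \<longleftrightarrow> indep_rows {..<n} ({..<n} \<times> {..<m})
      (\<lambda>a l. complex_of_real (ctrb_mat F G $$ (a, (\<lambda>(k,j). k * m + j) l)))"
    by (rule indep_rows_bij_betw[where e = "\<lambda>a. a", OF _ _ image_mult_add_lessThan, symmetric])
       (auto simp: bij_betw_def)
  also have "\<dots> \<longleftrightarrow> indep_rows {..<n} ({..<n} \<times> {..<m}) (\<lambda>a (k,j). (cmat F ^\<^sub>m k * cmat G) $$ (a,j))"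
  proof (rule indep_rows_cong)
    fix a l assume "a \<in> {..<n}" "l \<in> {..<n} \<times> {..<m}"
    then show "complex_of_real (ctrb_mat F G $$ (a, (\<lambda>(k,j). k * m + j) l)) =
        (\<lambda>(k,j). (cmat F ^\<^sub>m k * cmat G) $$ (a,j)) l"
      using F G mult_add_less_mult
      unfolding cmat_pow_mult[OF F G, symmetric] by (auto simp: ctrb_mat_def)
  qed
  also have "\<dots> \<longleftrightarrow> (\<forall>q. (\<forall>k<n. \<forall>j<m. row_times q (cmat F ^\<^sub>m k * cmat G) j = 0) \<longrightarrow> (\<forall>a<n. q a = 0))"
    using F unfolding indep_rows_def row_times_def by auto
  finally show ?thesis .
qed

lemma exists_annihilating_poly:
  fixes w :: "nat \<Rightarrow> nat \<Rightarrow> 'a::field"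
  obtains p where "p \<noteq> 0" "degree p \<le> n" "\<And>b. b < n \<Longrightarrow> (\<Sum>k\<le>n. coeff p k * w k b) = 0"
proof -
  have "\<not> indep_rows {..n} {..<n} w" using indep_rows_imp_card_le[of "{..n}" "{..<n}" w] by auto
  then obtain c k where c: "\<And>b. b < n \<Longrightarrow> (\<Sum>k\<le>n. c k * w k b) = 0" and k: "k \<le> n" "c k \<noteq> 0"
    unfolding indep_rows_def by auto
  define p where "p = (\<Sum>k\<le>n. monom (c k) k)"
  have coeff_p: "coeff p k = (if k \<le> n then c k else 0)" for k
    unfolding p_def coeff_sum by (simp add: sum.delta)
  show thesis
  proof (rule that)
    show "p \<noteq> 0" using k coeff_p by (metis coeff_0)
    show "degree p \<le> n" by (rule degree_le) (simp add: coeff_p)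
    show "(\<Sum>k\<le>n. coeff p k * w k b) = 0" if "b < n" for b using c[OF that] by (simp add: coeff_p)
  qed
qed

lemma sum_coeff_linear_factor_mult:
  fixes p :: "'a::comm_ring_1 poly"
  assumes "degree p < n"
  shows "(\<Sum>k\<le>n. coeff ([:-\<mu>, 1:] * p) k * w k) =
    (\<Sum>k<n. coeff p k * w (Suc k)) - \<mu> * (\<Sum>k<n. coeff p k * w k)"
proof -
  have "[:-\<mu>, 1:] * p = pCons 0 p - smult \<mu> p" by simp
  then have "(\<Sum>k\<le>n. coeff ([:-\<mu>, 1:] * p) k * w k) =
      (\<Sum>k\<le>n. coeff (pCons 0 p) k * w k) - \<mu> * (\<Sum>k\<le>n. coeff p k * w k)"
    by (simp only: coeff_diff coeff_smult left_diff_distrib sum_subtractf sum_distrib_left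
        mult.assoc)
  also have "(\<Sum>k\<le>n. coeff (pCons 0 p) k * w k) = (\<Sum>k<n. coeff p k * w (Suc k))"
    by (subst sum.atMost_shift) simp
  also have "(\<Sum>k\<le>n. coeff p k * w k) = (\<Sum>k<n. coeff p k * w k)"
    using assms by (simp add: lessThan_Suc_atMost[symmetric] coeff_eq_0)
  finally show ?thesis .
qed

text \<open>Splitting a linear factor off a polynomial of minimal degree annihilating the Krylov sequence
  leaves a combination that the shift of the sequence multiplies by the corresponding root.\<close>

lemma krylov_eigenvector:
  fixes w :: "nat \<Rightarrow> nat \<Rightarrow> complex"
  assumes w0: "b0 < n" "w 0 b0 \<noteq> 0"
  obtains c \<mu> b where "b < n" "(\<Sum>k<n. c k * w k b) \<noteq> 0"
    and "\<forall>b<n. (\<Sum>k<n. c k * w (Suc k) b) = \<mu> * (\<Sum>k<n. c k * w k b)"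
proof -
  define ev where "ev p b = (\<Sum>k\<le>n. coeff p k * w k b)" for p b
  define annihilates where "annihilates p \<longleftrightarrow> p \<noteq> 0 \<and> degree p \<le> n \<and> (\<forall>b<n. ev p b = 0)" for p
  have "\<exists>p. annihilates p"
    by (rule exists_annihilating_poly[of n w]) (auto simp: annihilates_def ev_def)
  then obtain p where p: "annihilates p" and minimal: "\<And>p'. annihilates p' \<Longrightarrow> degree p \<le> degree p'"
    using ex_has_least_nat[of annihilates _ degree] by blast
  have "degree p \<noteq> 0"
  proof
    assume "degree p = 0"
    then obtain a where a: "p = [:a:]" by (rule degree_eq_zeroE)
    have "ev p b0 = a * w 0 b0" unfolding ev_def a by (subst sum.atMost_shift) simp
    then show False using p w0 a by (auto simp: annihilates_def)
  qed
  then obtain \<mu> where "poly p \<mu> = 0"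
    using fundamental_theorem_of_algebra[of p] constant_degree by metis
  then obtain p' where p': "p = [:-\<mu>, 1:] * p'" by (auto simp: poly_eq_0_iff_dvd dvd_def)
  have "p' \<noteq> 0" using p p' by (auto simp: annihilates_def)
  then have degree_p: "degree p = Suc (degree p')" unfolding p' by (subst degree_mult_eq) auto
  then have degree_p': "degree p' < n" using p by (simp add: annihilates_def)
  have ev_p': "ev p' b = (\<Sum>k<n. coeff p' k * w k b)" for b
    using degree_p' unfolding ev_def by (simp add: lessThan_Suc_atMost[symmetric] coeff_eq_0)
  have ev_p: "ev p b = (\<Sum>k<n. coeff p' k * w (Suc k) b) - \<mu> * ev p' b" for b
    unfolding ev_p' unfolding ev_def p' by (rule sum_coeff_linear_factor_mult[OF degree_p'])
  have "\<not> annihilates p'" using minimal[of p'] degree_p by auto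
  then obtain b where "b < n" "ev p' b \<noteq> 0" using \<open>p' \<noteq> 0\<close> degree_p' by (auto simp: annihilates_def)
  moreover have "(\<Sum>k<n. coeff p' k * w (Suc k) b) = \<mu> * ev p' b" if "b < n" for b
    using ev_p[of b] p that by (simp add: annihilates_def)
  ultimately show thesis using that unfolding ev_p' by blast
qed

definition pbh_poly :: "real mat \<Rightarrow> real mat \<Rightarrow> nat \<Rightarrow> nat \<Rightarrow> complex poly" where
  "pbh_poly F G a k = (if k < dim_row F then [:- of_real (F $$ (a,k)), of_bool (a = k):]
     else [:of_real (G $$ (a, k - dim_row F)):])"

lemma left_mult_pbh_poly:
  assumes F: "F \<in> carrier_mat n n" and G: "G \<in> carrier_mat n m"
  shows "k < n \<Longrightarrow> (\<Sum>a<n. q a * poly (pbh_poly F G a k) \<mu>) = \<mu> * q k - row_times q (cmat F) k"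
    and "j < m \<Longrightarrow> (\<Sum>a<n. q a * poly (pbh_poly F G a (n + j)) \<mu>) = row_times q (cmat G) j"
proof -
  assume "k < n"
  then have "(\<Sum>a<n. q a * poly (pbh_poly F G a k) \<mu>) =
      (\<Sum>a<n. \<mu> * (of_bool (a = k) * q a) - q a * cmat F $$ (a,k))"
    using F by (intro sum.cong) (auto simp: pbh_poly_def algebra_simps)
  then show "(\<Sum>a<n. q a * poly (pbh_poly F G a k) \<mu>) = \<mu> * q k - row_times q (cmat F) k"
    using F \<open>k < n\<close> by (simp add: sum_subtractf row_times_def flip: sum_distrib_left)
next
  assume "j < m"
  then show "(\<Sum>a<n. q a * poly (pbh_poly F G a (n + j)) \<mu>) = row_times q (cmat G) j"
    using F G by (simp add: pbh_poly_def row_times_def)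
qed

lemma indep_rows_pbh_poly_iff:
  assumes F: "F \<in> carrier_mat n n" and G: "G \<in> carrier_mat n m"
  shows "indep_rows {..<n} {..<n+m} (\<lambda>a k. poly (pbh_poly F G a k) \<mu>) \<longleftrightarrow>
    (\<forall>q. (\<forall>k<n. row_times q (cmat F) k = \<mu> * q k) \<longrightarrow> (\<forall>j<m. row_times q (cmat G) j = 0) \<longrightarrow>
      (\<forall>a<n. q a = 0))"
proof -
  have split: "(\<forall>k\<in>{..<n+m}. Q k) \<longleftrightarrow> (\<forall>k<n. Q k) \<and> (\<forall>j<m. Q (n + j))" for Q :: "nat \<Rightarrow> bool"
  proof -
    have "Q k" if "\<forall>k<n. Q k" "\<forall>j<m. Q (n + j)" "k < n + m" for k
      using that(1,3) that(2)[rule_format, of "k - n"] by (cases "k < n") auto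
    then show ?thesis by auto
  qed
  have "(\<forall>k\<in>{..<n+m}. (\<Sum>a<n. q a * poly (pbh_poly F G a k) \<mu>) = 0) \<longleftrightarrow>
      (\<forall>k<n. row_times q (cmat F) k = \<mu> * q k) \<and> (\<forall>j<m. row_times q (cmat G) j = 0)" for q
    unfolding split using left_mult_pbh_poly[OF F G, where q = q and \<mu> = \<mu>] by auto
  then show ?thesis unfolding indep_rows_def by (simp add: imp_conjL Ball_def)
qed

lemma row_times_pow_eigenvector:
  assumes F: "F \<in> carrier_mat n n" and "\<And>k. k < n \<Longrightarrow> row_times q F k = \<mu> * q k" and "b < n"
  shows "row_times q (F ^\<^sub>m k) b = \<mu> ^ k * q b"
  using \<open>b < n\<close>
proof (induction k arbitrary: b)
  case (Suc k)
  have "row_times q (F ^\<^sub>m Suc k) b = row_times (row_times q (F ^\<^sub>m k)) F b"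
    using F Suc.prems by (simp add: row_times_mult[of _ n n _ n])
  also have "\<dots> = row_times (\<lambda>b. \<mu> ^ k * q b) F b"
    using F by (intro row_times_cong) (simp add: Suc.IH)
  finally show ?case using assms(2) Suc.prems by (simp add: row_times_scale)
qed (use F in simp)

lemma controllable_imp_pbh:
  assumes F: "F \<in> carrier_mat n n" and G: "G \<in> carrier_mat n m" and "controllable F G"
  shows "indep_rows {..<n} {..<n+m} (\<lambda>a k. poly (pbh_poly F G a k) \<mu>)"
  unfolding indep_rows_pbh_poly_iff[OF F G]
proof (intro allI impI)
  fix q a assume qF: "\<forall>k<n. row_times q (cmat F) k = \<mu> * q k"
    and qG: "\<forall>j<m. row_times q (cmat G) j = 0" and a: "a < n"
  have "row_times q (cmat F ^\<^sub>m k * cmat G) j = 0" if "j < m" for k j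
  proof -
    have "row_times q (cmat F ^\<^sub>m k * cmat G) j = row_times (row_times q (cmat F ^\<^sub>m k)) (cmat G) j"
      using F G that by (intro row_times_mult[of _ n n _ m]) auto
    also have "\<dots> = row_times (\<lambda>b. \<mu> ^ k * q b) (cmat G) j"
      using F G qF by (intro row_times_cong) (simp add: row_times_pow_eigenvector)
    finally show ?thesis using qG that by (simp add: row_times_scale)
  qed
  then show "q a = 0" using assms(3) a unfolding controllable_iff_annihilator[OF F G] by blast
qed

lemma pbh_imp_controllable:
  assumes F: "F \<in> carrier_mat n n" and G: "G \<in> carrier_mat n m"
    and pbh: "\<And>\<mu>. indep_rows {..<n} {..<n+m} (\<lambda>a k. poly (pbh_poly F G a k) \<mu>)"
  shows "controllable F G"
  unfolding controllable_iff_annihilator[OF F G]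
proof (intro allI impI, rule ccontr)
  fix q a assume q: "\<forall>k<n. \<forall>j<m. row_times q (cmat F ^\<^sub>m k * cmat G) j = 0" and a: "a < n" "q a \<noteq> 0"
  define w where "w k = row_times q (cmat F ^\<^sub>m k)" for k
  have "w 0 a \<noteq> 0" using a F by (simp add: w_def)
  then obtain c \<mu> b where b: "b < n" "(\<Sum>k<n. c k * w k b) \<noteq> 0"
    and eigen: "\<forall>b<n. (\<Sum>k<n. c k * w (Suc k) b) = \<mu> * (\<Sum>k<n. c k * w k b)"
    by (rule krylov_eigenvector[OF a(1)])
  let ?v = "\<lambda>b. \<Sum>k<n. c k * w k b"
  have w_F: "row_times (w k) (cmat F) b = w (Suc k) b" if "b < n" for k b
    using F that by (simp add: w_def row_times_mult[of _ n n _ n])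
  have w_G: "row_times (w k) (cmat G) j = 0" if "k < n" "j < m" for k j
    using F G q that by (simp add: w_def flip: row_times_mult[of _ n n _ m])
  have "row_times ?v (cmat F) b = \<mu> * ?v b" if "b < n" for b
    using eigen that by (simp add: row_times_sum w_F)
  moreover have "row_times ?v (cmat G) j = 0" if "j < m" for j
    using that by (simp add: row_times_sum w_G)
  ultimately show False using pbh[of \<mu>] b unfolding indep_rows_pbh_poly_iff[OF F G] by blast
qed

section \<open>The resolvent\<close>

definition resolvent_numerator :: "'a::field mat \<Rightarrow> 'a mat \<Rightarrow> 'a poly mat" where
  "resolvent_numerator F M = adj_mat (char_poly_matrix F) * map_mat (\<lambda>x. [:x:]) M"

lemma resolvent_numerator_carrier:
  assumes "F \<in> carrier_mat n n" "M \<in> carrier_mat n p"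
  shows "resolvent_numerator F M \<in> carrier_mat n p"
  unfolding resolvent_numerator_def
  using adj_mat(1)[OF char_poly_matrix_closed[OF assms(1)]] assms(2) by simp

lemma char_poly_matrix_mult_resolvent_numerator:
  assumes F: "F \<in> carrier_mat n n" and M: "M \<in> carrier_mat n p"
  shows "char_poly_matrix F * resolvent_numerator F M = char_poly F \<cdot>\<^sub>m map_mat (\<lambda>x. [:x:]) M"
proof -
  let ?C = "char_poly_matrix F" and ?M = "map_mat (\<lambda>x. [:x:]) M"
  have C: "?C \<in> carrier_mat n n" using F by simp
  have cM: "?M \<in> carrier_mat n p" using M by simp
  have "?C * resolvent_numerator F M = (?C * adj_mat ?C) * ?M"
    unfolding resolvent_numerator_def using assoc_mult_mat[OF C adj_mat(1)[OF C] cM] by simp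
  also have "\<dots> = (char_poly F \<cdot>\<^sub>m 1\<^sub>m n) * ?M"
    unfolding adj_mat(2)[OF C] char_poly_def ..
  also have "\<dots> = char_poly F \<cdot>\<^sub>m ?M"
    using mult_smult_assoc_mat[OF one_carrier_mat cM] left_mult_one_mat[OF cM] by simp
  finally show ?thesis .
qed

lemma map_poly_char_poly_matrix:
  assumes "F \<in> carrier_mat n n"
  shows "map_mat (\<lambda>p. poly p \<mu>) (char_poly_matrix F) = \<mu> \<cdot>\<^sub>m 1\<^sub>m n - F"
  using assms by (intro eq_matI) (auto simp: char_poly_matrix_def)

lemma poly_char_poly_eq_det:
  assumes "F \<in> carrier_mat n n"
  shows "poly (char_poly F) \<mu> = det (\<mu> \<cdot>\<^sub>m 1\<^sub>m n - F)"
  unfolding char_poly_def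
  by (rule poly_det_cong[of _ n])
     (use assms in \<open>auto simp: char_poly_matrix_def intro!: minus_carrier_mat\<close>)

lemma exists_resolvent:
  fixes F :: "'a::field mat"
  assumes F: "F \<in> carrier_mat n n" and "poly (char_poly F) \<mu> \<noteq> 0"
  obtains R where "R \<in> carrier_mat n n" "R * (\<mu> \<cdot>\<^sub>m 1\<^sub>m n - F) = 1\<^sub>m n"
proof -
  have "\<mu> \<cdot>\<^sub>m 1\<^sub>m n - F \<in> Units (ring_mat TYPE('a) n ())"
    using F assms(2) unfolding poly_char_poly_eq_det[OF F]
    by (intro det_non_zero_imp_unit minus_carrier_mat)
  then show thesis using that unfolding Units_def by (auto simp: ring_mat_def)
qed

lemma poly_resolvent_numerator:
  assumes F: "F \<in> carrier_mat n n" and M: "M \<in> carrier_mat n p" and R: "R \<in> carrier_mat n n"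
    and inverse: "R * (\<mu> \<cdot>\<^sub>m 1\<^sub>m n - F) = 1\<^sub>m n" and "i < n" "j < p"
  shows "poly (resolvent_numerator F M $$ (i,j)) \<mu> = poly (char_poly F) \<mu> * (R * M) $$ (i,j)"
proof -
  let ?N = "\<mu> \<cdot>\<^sub>m 1\<^sub>m n - F" and ?E = "map_mat (\<lambda>p. poly p \<mu>)"
  let ?Q = "resolvent_numerator F M"
  have N: "?N \<in> carrier_mat n n" using F by (intro minus_carrier_mat)
  have C: "char_poly_matrix F \<in> carrier_mat n n" using F by simp
  have Q: "?Q \<in> carrier_mat n p" by (rule resolvent_numerator_carrier[OF F M])
  have "?N * ?E ?Q = ?E (char_poly F \<cdot>\<^sub>m map_mat (\<lambda>x. [:x:]) M)"
    unfolding map_poly_char_poly_matrix[OF F, symmetric]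
      semiring_hom.mat_hom_mult[OF poly_hom.semiring_hom_axioms C Q, symmetric]
      char_poly_matrix_mult_resolvent_numerator[OF F M] ..
  also have "\<dots> = poly (char_poly F) \<mu> \<cdot>\<^sub>m M" by (intro eq_matI) auto
  finally have "(R * ?N) * ?E ?Q = R * (poly (char_poly F) \<mu> \<cdot>\<^sub>m M)"
    using assoc_mult_mat[OF R N, of "?E ?Q" p] Q by simp
  then have "?E ?Q = poly (char_poly F) \<mu> \<cdot>\<^sub>m (R * M)"
    using Q left_mult_one_mat[of "?E ?Q" n p] mult_smult_distrib[OF R M] unfolding inverse by simp
  then have "?E ?Q $$ (i,j) = (poly (char_poly F) \<mu> \<cdot>\<^sub>m (R * M)) $$ (i,j)" by simp
  then show ?thesis using Q R M \<open>i < n\<close> \<open>j < p\<close> by simp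
qed

lemma degree_resolvent_numerator:
  assumes F: "F \<in> carrier_mat n n" and M: "M \<in> carrier_mat n p" and i: "i < n" and j: "j < p"
  shows "degree (resolvent_numerator F M $$ (i,j)) < n"
proof -
  let ?C = "char_poly_matrix F"
  have C: "?C \<in> carrier_mat n n" using F by simp
  have "degree (?C $$ (a,b)) \<le> 1" if "a < n" "b < n" for a b
    using F that by (auto simp: char_poly_matrix_def)
  then have "degree (det (mat_delete ?C b i)) \<le> 1 * (n - 1)" if "b < n" for b
    using C that i by (intro degree_det_le) (auto simp: mat_delete_def)
  then have adj: "degree (adj_mat ?C $$ (i,b)) \<le> n - 1" if "b < n" for b
    using C that i by (simp add: adj_mat_def cofactor_def degree_mult_le minus_one_power_iff)
  have "resolvent_numerator F M $$ (i,j) = (\<Sum>b<n. adj_mat ?C $$ (i,b) * [:M $$ (b,j):])"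
    unfolding resolvent_numerator_def using adj_mat(1)[OF C] M i j
    by (simp add: scalar_prod_def atLeast0LessThan)
  also have "degree \<dots> \<le> n - 1"
    using adj by (intro degree_sum_le) (auto intro!: order.trans[OF degree_mult_le])
  finally show ?thesis using i by simp
qed

lemma mult_resolvent_numerator:
  assumes F: "F \<in> carrier_mat n n" and M: "M \<in> carrier_mat n p" and b: "b < n" and j: "j < p"
  shows "(\<Sum>c<n. smult (F $$ (b,c)) (resolvent_numerator F M $$ (c,j))) =
    pCons 0 (resolvent_numerator F M $$ (b,j)) - smult (M $$ (b,j)) (char_poly F)"
proof -
  let ?Q = "resolvent_numerator F M"
  have Q: "?Q \<in> carrier_mat n p" by (rule resolvent_numerator_carrier[OF F M])
  have "smult (M $$ (b,j)) (char_poly F) = (char_poly_matrix F * ?Q) $$ (b,j)"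
    unfolding char_poly_matrix_mult_resolvent_numerator[OF F M] using M b j by simp
  also have "\<dots> = (\<Sum>c<n. char_poly_matrix F $$ (b,c) * ?Q $$ (c,j))"
    using char_poly_matrix_closed[OF F] Q b j by (simp add: scalar_prod_def atLeast0LessThan)
  also have "\<dots> = (\<Sum>c<n. (if b = c then pCons 0 (?Q $$ (c,j)) else 0) -
      smult (F $$ (b,c)) (?Q $$ (c,j)))"
    using F b by (intro sum.cong) (auto simp: char_poly_matrix_def)
  also have "\<dots> = pCons 0 (?Q $$ (b,j)) - (\<Sum>c<n. smult (F $$ (b,c)) (?Q $$ (c,j)))"
    using b by (simp add: sum_subtractf)
  finally show ?thesis by (simp add: algebra_simps)
qed

lemma pow_Suc_mult_resolvent_numerator:
  assumes F: "F \<in> carrier_mat n n" and M: "M \<in> carrier_mat n p" and i: "i < n" and j: "j < p"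
  shows "(\<Sum>b<n. smult ((F ^\<^sub>m Suc k) $$ (i,b)) (resolvent_numerator F M $$ (b,j))) =
    pCons 0 (\<Sum>b<n. smult ((F ^\<^sub>m k) $$ (i,b)) (resolvent_numerator F M $$ (b,j)))
    - smult ((F ^\<^sub>m k * M) $$ (i,j)) (char_poly F)"
proof -
  let ?Q = "resolvent_numerator F M"
  have Fk: "F ^\<^sub>m k \<in> carrier_mat n n" using F by simp
  have "(\<Sum>b<n. smult ((F ^\<^sub>m Suc k) $$ (i,b)) (?Q $$ (b,j))) =
      (\<Sum>c<n. \<Sum>b<n. smult ((F ^\<^sub>m k) $$ (i,b)) (smult (F $$ (b,c)) (?Q $$ (c,j))))"
    using F Fk i by (intro sum.cong refl) (simp add: scalar_prod_def atLeast0LessThan smult_sum)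
  also have "\<dots> = (\<Sum>b<n. smult ((F ^\<^sub>m k) $$ (i,b)) (\<Sum>c<n. smult (F $$ (b,c)) (?Q $$ (c,j))))"
    unfolding smult_sum2 by (rule sum.swap)
  also have "\<dots> = (\<Sum>b<n. [:0,1:] * smult ((F ^\<^sub>m k) $$ (i,b)) (?Q $$ (b,j))
      - smult ((F ^\<^sub>m k) $$ (i,b) * M $$ (b,j)) (char_poly F))"
    by (intro sum.cong refl) (simp add: mult_resolvent_numerator[OF F M _ j] smult_diff_right)
  also have "\<dots> = pCons 0 (\<Sum>b<n. smult ((F ^\<^sub>m k) $$ (i,b)) (?Q $$ (b,j)))
      - smult (\<Sum>b<n. (F ^\<^sub>m k) $$ (i,b) * M $$ (b,j)) (char_poly F)"
    unfolding sum_subtractf sum_distrib_left[symmetric] smult_sum by simp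
  also have "(\<Sum>b<n. (F ^\<^sub>m k) $$ (i,b) * M $$ (b,j)) = (F ^\<^sub>m k * M) $$ (i,j)"
    using F Fk M i j by (simp add: scalar_prod_def atLeast0LessThan)
  finally show ?thesis .
qed

text \<open>Clearing denominators, \<open>e\<^sub>i F\<^sup>k (\<lambda> I - F)\<inverse> M e\<^sub>j\<close> satisfies a recursion in \<open>k\<close> whose
  inhomogeneity is \<open>(F\<^sup>k M)\<^sub>i\<^sub>j\<close> times the characteristic polynomial; that polynomial has too
  large a degree to occur.\<close>

lemma resolvent_numerator_eq_0_imp_pow_eq_0:
  assumes F: "F \<in> carrier_mat n n" and M: "M \<in> carrier_mat n p" and i: "i < n" and j: "j < p"
    and zero: "resolvent_numerator F M $$ (i,j) = 0"
  shows "(F ^\<^sub>m k * M) $$ (i,j) = 0"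
proof -
  let ?Q = "resolvent_numerator F M"
  have char_poly: "degree (char_poly F) = n" "char_poly F \<noteq> 0"
    using degree_monic_char_poly[OF F] by auto
  define f where "f k = (\<Sum>b<n. smult ((F ^\<^sub>m k) $$ (i,b)) (?Q $$ (b,j)))" for k
  have f_Suc: "f (Suc k) = pCons 0 (f k) - smult ((F ^\<^sub>m k * M) $$ (i,j)) (char_poly F)" for k
    unfolding f_def by (rule pow_Suc_mult_resolvent_numerator[OF F M i j])
  have degree_f: "degree (f k) < n" for k
  proof -
    have "degree (smult ((F ^\<^sub>m k) $$ (i,b)) (?Q $$ (b,j))) < n" if "b < n" for b
      using degree_resolvent_numerator[OF F M that j] degree_smult_le
      by (rule le_less_trans[rotated])
    then show ?thesis unfolding f_def using i by (intro degree_sum_less) auto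
  qed
  have pow_eq_0: "(F ^\<^sub>m k * M) $$ (i,j) = 0" if "f k = 0" for k
    using degree_f[of "Suc k"] char_poly unfolding f_Suc that by (auto split: if_splits)
  have "f k = 0" for k
  proof (induction k)
    case 0
    have "f 0 = (\<Sum>b<n. of_bool (b = i) * ?Q $$ (b,j))"
      unfolding f_def using F i by (intro sum.cong) auto
    then show ?case using i zero by simp
  next
    case (Suc k)
    then show ?case using pow_eq_0[OF Suc] by (simp add: f_Suc)
  qed
  then show ?thesis by (rule pow_eq_0)
qed

lemma exists_resolvent_numerator_one_ne_0:
  assumes F: "F \<in> carrier_mat n n" and i: "i < n"
  shows "\<exists>j<n. resolvent_numerator F (1\<^sub>m n) $$ (i,j) \<noteq> 0"
proof (rule ccontr)
  assume "\<not> ?thesis"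
  then have "(F ^\<^sub>m 0 * 1\<^sub>m n) $$ (i,i) = 0"
    by (intro resolvent_numerator_eq_0_imp_pow_eq_0[OF F one_carrier_mat i i]) (use i in blast)
  then show False using F i by simp
qed

lemma resolvent_entry_nz_iff:
  assumes A: "A \<in> carrier_mat n n" and M: "M \<in> carrier_mat n p" and ij: "i < n" "j < p"
  shows "resolvent_entry_nz A M i j \<longleftrightarrow> resolvent_numerator (cmat A) (cmat M) $$ (i,j) \<noteq> 0"
proof -
  have cmat_A: "cmat A \<in> carrier_mat n n" and cM: "cmat M \<in> carrier_mat n p" using A M by auto
  note poly_Q = poly_resolvent_numerator[OF cmat_A cM _ _ ij]
  show ?thesis
  proof
    assume "resolvent_entry_nz A M i j"
    then obtain \<mu> R where R: "R \<in> carrier_mat n n" "R * (\<mu> \<cdot>\<^sub>m 1\<^sub>m n - cmat A) = 1\<^sub>m n"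
      and ne: "(R * cmat M) $$ (i,j) \<noteq> 0"
      using A unfolding resolvent_entry_nz_def by auto
    have "det R * poly (char_poly (cmat A)) \<mu> = 1"
      using det_mult[OF R(1), of "\<mu> \<cdot>\<^sub>m 1\<^sub>m n - cmat A"] cmat_A R(2)
      unfolding poly_char_poly_eq_det[OF cmat_A] by (simp add: minus_carrier_mat)
    then show "resolvent_numerator (cmat A) (cmat M) $$ (i,j) \<noteq> 0"
      using poly_Q[OF R] ne by auto
  next
    assume "resolvent_numerator (cmat A) (cmat M) $$ (i,j) \<noteq> 0"
    moreover have "char_poly (cmat A) \<noteq> 0" using degree_monic_char_poly[OF cmat_A] by auto
    ultimately have "resolvent_numerator (cmat A) (cmat M) $$ (i,j) * char_poly (cmat A) \<noteq> 0"
      by simp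
    then obtain \<mu> where
      "poly (resolvent_numerator (cmat A) (cmat M) $$ (i,j) * char_poly (cmat A)) \<mu> \<noteq> 0"
      using poly_all_0_iff_0 by blast
    then have \<mu>: "poly (resolvent_numerator (cmat A) (cmat M) $$ (i,j)) \<mu> \<noteq> 0"
      "poly (char_poly (cmat A)) \<mu> \<noteq> 0" by auto
    obtain R where R: "R \<in> carrier_mat n n" "R * (\<mu> \<cdot>\<^sub>m 1\<^sub>m n - cmat A) = 1\<^sub>m n"
      by (rule exists_resolvent[OF cmat_A \<mu>(2)])
    then show "resolvent_entry_nz A M i j"
      using poly_Q[OF R] \<mu>(1) A unfolding resolvent_entry_nz_def by auto
  qed
qed

lemma left_kernel_off_column:
  fixes R :: "'a::field mat"
  assumes R: "R \<in> carrier_mat n n" and N: "N \<in> carrier_mat n n" and "R * N = 1\<^sub>m n"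
    and l: "l < n" and b: "b < n" and kernel: "\<And>k. k < n \<Longrightarrow> k \<noteq> l \<Longrightarrow> row_times q N k = 0"
  shows "q b = row_times q N l * R $$ (l,b)"
proof -
  have "N * R = 1\<^sub>m n" by (rule mat_mult_left_right_inverse[OF assms(1-3)])
  then have "q b = row_times (row_times q N) R b" using row_times_mult[OF N R b, of q] b by simp
  also have "\<dots> = (\<Sum>k<n. of_bool (k = l) * (row_times q N l * R $$ (l,b)))"
    unfolding row_times_def[of _ R] using R kernel by (intro sum.cong) auto
  finally show ?thesis using l by simp
qed

section \<open>The perturbed system\<close>

lemma hconcat_carrier:
  "M \<in> carrier_mat r c \<Longrightarrow> N \<in> carrier_mat r d \<Longrightarrow> hconcat M N \<in> carrier_mat r (c + d)"
  by (auto simp: hconcat_def)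

lemma hconcat_index:
  assumes "M \<in> carrier_mat r c" "N \<in> carrier_mat r d" "i < r" "j < c + d"
  shows "hconcat M N $$ (i,j) = (if j < c then M $$ (i,j) else N $$ (i, j - c))"
  using assms by (auto simp: hconcat_def)

lemma Max_eq_bound_iff:
  assumes "S \<noteq> {}" "\<And>x. x \<in> S \<Longrightarrow> x \<le> (b::nat)"
  shows "Max S = b \<longleftrightarrow> b \<in> S"
proof -
  have "finite S" using assms(2) by (meson finite_nat_set_iff_bounded_le)
  then show ?thesis using assms by (metis Max_eqI Max_in)
qed

locale perturbed_system =
  fixes A B :: "real mat" and PA PB :: "bool mat" and n m :: nat
  assumes A: "A \<in> carrier_mat n n" and B: "B \<in> carrier_mat n m"
    and PA: "PA \<in> carrier_mat n n" and PB: "PB \<in> carrier_mat n m"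
begin

lemma cmat_A: "cmat A \<in> carrier_mat n n" and cmat_B: "cmat B \<in> carrier_mat n m"
  using A B by simp_all

definition free :: "(nat \<times> nat) set" where
  "free = {(a,k). a < n \<and> k < n + m \<and> hconcat PA PB $$ (a,k)}"

lemma free_iff:
  "(a,k) \<in> free \<longleftrightarrow> a < n \<and> k < n + m \<and> (if k < n then PA $$ (a,k) else PB $$ (a, k - n))"
  unfolding free_def using hconcat_index[OF PA PB] by auto

abbreviation pencil :: "(nat \<times> nat \<Rightarrow> real) \<Rightarrow> complex \<Rightarrow> nat \<Rightarrow> nat \<Rightarrow> complex" where
  "pencil \<equiv> free_pencil (pbh_poly A B) free"

abbreviation base_pencil :: "complex \<Rightarrow> nat \<Rightarrow> nat \<Rightarrow> complex" where
  "base_pencil \<equiv> pencil (\<lambda>_. 0)"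

abbreviation full_row_rank :: "(nat \<times> nat \<Rightarrow> real) \<Rightarrow> complex \<Rightarrow> bool" where
  "full_row_rank \<theta> \<mu> \<equiv> indep_rows {..<n} {..<n+m} (pencil \<theta> \<mu>)"

text \<open>The sign in \<open>dA\<close> makes \<open>\<lambda>I - A - dA\<close> the entrywise sum of the unperturbed pencil and \<open>\<theta>\<close>.\<close>
definition dA :: "(nat \<times> nat \<Rightarrow> real) \<Rightarrow> real mat" where
  "dA \<theta> = mat n n (\<lambda>(a,k). if (a,k) \<in> free then - \<theta> (a,k) else 0)"

definition dB :: "(nat \<times> nat \<Rightarrow> real) \<Rightarrow> real mat" where
  "dB \<theta> = mat n m (\<lambda>(a,k). if (a,n+k) \<in> free then \<theta> (a, n + k) else 0)"

lemma dA_carrier [simp]: "dA \<theta> \<in> carrier_mat n n" and dB_carrier [simp]: "dB \<theta> \<in> carrier_mat n m"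
  by (simp_all add: dA_def dB_def)

lemma dA_dim [simp]: "dim_row (dA \<theta>) = n" "dim_col (dA \<theta>) = n"
  and dB_dim [simp]: "dim_row (dB \<theta>) = n" "dim_col (dB \<theta>) = m"
  by (simp_all add: dA_def dB_def)

lemma realizations_iff:
  "M \<in> realizations PA \<and> N \<in> realizations PB \<longleftrightarrow> (\<exists>\<theta>. M = dA \<theta> \<and> N = dB \<theta>)"
proof
  assume MN: "M \<in> realizations PA \<and> N \<in> realizations PB"
  let ?\<theta> = "\<lambda>(a,k). if k < n then - M $$ (a,k) else N $$ (a, k - n)"
  have "M = dA ?\<theta>" "N = dB ?\<theta>"
    using MN PA PB by (auto intro!: eq_matI simp: realizations_def dA_def dB_def free_iff)
  then show "\<exists>\<theta>. M = dA \<theta> \<and> N = dB \<theta>" by blast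
next
  assume "\<exists>\<theta>. M = dA \<theta> \<and> N = dB \<theta>"
  then show "M \<in> realizations PA \<and> N \<in> realizations PB"
    using PA PB by (auto simp: realizations_def dA_def dB_def free_iff)
qed

lemma pencil_eq_pbh_poly:
  assumes "a < n" "k < n + m"
  shows "pencil \<theta> \<mu> a k = poly (pbh_poly (A + dA \<theta>) (B + dB \<theta>) a k) \<mu>"
  using assms A B by (auto simp: free_pencil_def pbh_poly_def dA_def dB_def)

lemma struct_controllable_iff_parameter:
  "struct_controllable A B PA PB \<longleftrightarrow> (\<exists>\<theta>. controllable (A + dA \<theta>) (B + dB \<theta>))"
proof -
  have "struct_controllable A B PA PB \<longleftrightarrow>
      (\<exists>M N. (M \<in> realizations PA \<and> N \<in> realizations PB) \<and> controllable (A + M) (B + N))"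
    unfolding struct_controllable_def by blast
  also have "\<dots> \<longleftrightarrow> (\<exists>\<theta>. controllable (A + dA \<theta>) (B + dB \<theta>))"
    unfolding realizations_iff by blast
  finally show ?thesis .
qed

lemma struct_controllable_iff_pencil:
  "struct_controllable A B PA PB \<longleftrightarrow> (\<exists>\<theta>. \<forall>\<mu>. full_row_rank \<theta> \<mu>)"
proof -
  have carriers: "A + dA \<theta> \<in> carrier_mat n n" "B + dB \<theta> \<in> carrier_mat n m" for \<theta> by auto
  have "full_row_rank \<theta> \<mu> \<longleftrightarrow>
      indep_rows {..<n} {..<n+m} (\<lambda>a k. poly (pbh_poly (A + dA \<theta>) (B + dB \<theta>) a k) \<mu>)" for \<theta> \<mu>
    by (rule indep_rows_cong) (simp add: pencil_eq_pbh_poly)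
  then show ?thesis
    unfolding struct_controllable_iff_parameter
    using controllable_imp_pbh[OF carriers] pbh_imp_controllable[OF carriers] by blast
qed

lemma max_pert_rank_iff:
  "max_pert_rank A B PA PB \<mu> = n \<longleftrightarrow> (\<exists>\<theta>. full_row_rank \<theta> \<mu>)"
proof -
  define W where "W M N = hconcat (\<mu> \<cdot>\<^sub>m 1\<^sub>m n - cmat A - cmat M) (cmat (B + N))" for M N
  define r where "r \<theta> = vec_space.rank n (W (dA \<theta>) (dB \<theta>))" for \<theta>
  have W: "W (dA \<theta>) (dB \<theta>) \<in> carrier_mat n (n + m)" for \<theta>
    unfolding W_def by (rule hconcat_carrier) (auto intro!: minus_carrier_mat)
  have "W (dA \<theta>) (dB \<theta>) $$ (a,k) = pencil \<theta> \<mu> a k" if "a < n" "k < n + m" for \<theta> a k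
    using that A B unfolding W_def
    by (subst hconcat_index[OF _ _ that])
       (auto simp: free_pencil_def pbh_poly_def dA_def dB_def intro!: minus_carrier_mat)
  then have r_eq_iff: "r \<theta> = n \<longleftrightarrow> full_row_rank \<theta> \<mu>" for \<theta>
    unfolding r_def rank_eq_dim_row_iff[OF W] by (intro indep_rows_cong) auto
  have "{vec_space.rank (dim_row A)
        (hconcat (\<mu> \<cdot>\<^sub>m 1\<^sub>m (dim_row A) - cmat A - cmat M) (cmat (B + N))) | M N.
       M \<in> realizations PA \<and> N \<in> realizations PB} = range r"
    unfolding realizations_iff W_def r_def using A by auto
  then have "max_pert_rank A B PA PB \<mu> = n \<longleftrightarrow> Max (range r) = n" unfolding max_pert_rank_def by simp
  also have "\<dots> \<longleftrightarrow> n \<in> range r"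
    by (rule Max_eq_bound_iff) (auto simp: r_def rank_le_dim_row[OF W])
  also have "\<dots> \<longleftrightarrow> (\<exists>\<theta>. full_row_rank \<theta> \<mu>)"
    unfolding image_iff r_eq_iff[symmetric] by (auto simp: eq_commute)
  finally show ?thesis .
qed

lemma resolvent_matrix_index:
  assumes "a < n" "k < n"
  shows "(\<mu> \<cdot>\<^sub>m 1\<^sub>m n - cmat A) $$ (a,k) = base_pencil \<mu> a k"
  using assms A by (auto simp: free_pencil_def pbh_poly_def)

lemma indep_rows_pencil_of_not_eigenvalue:
  assumes "\<not> eigenvalue (cmat A) \<mu>"
  shows "indep_rows {..<n} {..<n} (base_pencil \<mu>)"
proof -
  have "det (\<mu> \<cdot>\<^sub>m 1\<^sub>m n - cmat A) \<noteq> 0"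
    using assms unfolding eigenvalue_root_char_poly[OF cmat_A] poly_char_poly_eq_det[OF cmat_A] .
  also have "\<mu> \<cdot>\<^sub>m 1\<^sub>m n - cmat A = mat n n (\<lambda>(a,k). base_pencil \<mu> a k)"
    using A by (intro eq_matI) (auto simp: free_pencil_def pbh_poly_def)
  finally show ?thesis unfolding det_ne_0_iff_indep_rows .
qed

lemma exists_not_eigenvalue: "\<exists>\<mu>. \<not> eigenvalue (cmat A) \<mu>"
proof -
  have "char_poly (cmat A) \<noteq> 0" using degree_monic_char_poly[OF cmat_A] by auto
  then show ?thesis unfolding eigenvalue_root_char_poly[OF cmat_A] using poly_all_0_iff_0 by blast
qed

subsection \<open>The auxiliary connection digraph\<close>

abbreviation reachable :: "vertex \<Rightarrow> bool" where
  "reachable \<equiv> input_reachable A B PA PB"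

lemma acg_edges_iff:
  "(X j, Z i) \<in> acg_edges A B PA PB \<longleftrightarrow> i < n \<and> j < n \<and> resolvent_entry_nz A (1\<^sub>m n) i j"
  "(U j, Z i) \<in> acg_edges A B PA PB \<longleftrightarrow>
    j < m \<and> (if i < n then resolvent_entry_nz A B i j else i = n + j)"
  "(Z i, X j) \<in> acg_edges A B PA PB \<longleftrightarrow> (j,i) \<in> free"
  using A B PA PB by (auto simp: acg_edges_def E_xz_def E_uz_def E_zx_def free_def Let_def)

lemma acg_edges_cases:
  assumes "(v,w) \<in> acg_edges A B PA PB"
  obtains i j where "v = X j" "w = Z i"
    | i j where "v = U j" "w = Z i"
    | i j where "v = Z i" "w = X j"
  using assms by (auto simp: acg_edges_def E_xz_def E_uz_def E_zx_def Let_def)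

lemma reachable_input: "j < m \<Longrightarrow> reachable (U j)"
  using B unfolding input_reachable_def by auto

lemma reachable_step: "reachable v \<Longrightarrow> (v,w) \<in> acg_edges A B PA PB \<Longrightarrow> reachable w"
  unfolding input_reachable_def by (meson rtrancl.rtrancl_into_rtrancl)

lemma reachable_Z_input: "n \<le> i \<Longrightarrow> i < n + m \<Longrightarrow> reachable (Z i)"
  by (rule reachable_step[OF reachable_input[of "i - n"]]) (auto simp: acg_edges_iff)

lemma edge_input_reachable_iff_reachable_Z:
  "(\<forall>e \<in> E_xz A B. edge_input_reachable A B PA PB e) \<longleftrightarrow> (\<forall>i < n + m. reachable (Z i))"
proof (intro iffI allI impI)
  assume "\<forall>i < n + m. reachable (Z i)"
  then show "\<forall>e \<in> E_xz A B. edge_input_reachable A B PA PB e"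
    using A B unfolding E_xz_def edge_input_reachable_def by (auto simp: Let_def)
next
  fix i assume edges: "\<forall>e \<in> E_xz A B. edge_input_reachable A B PA PB e" and i: "i < n + m"
  show "reachable (Z i)"
  proof (cases "i < n")
    case True
    obtain j where "j < n" "resolvent_entry_nz A (1\<^sub>m n) i j"
      using exists_resolvent_numerator_one_ne_0[OF cmat_A True]
      unfolding resolvent_entry_nz_iff[OF A one_carrier_mat True] by auto
    then have edge: "(X j, Z i) \<in> E_xz A B" using True A B by (auto simp: E_xz_def Let_def)
    then have "reachable (X j) \<or> reachable (Z i)"
      using edges unfolding edge_input_reachable_def by force
    then show ?thesis using reachable_step[of "X j" "Z i"] edge by (auto simp: acg_edges_def)
  qed (use i reachable_Z_input in simp)
qed

subsection \<open>Sufficiency\<close>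

definition avoidable :: "nat \<Rightarrow> bool" where
  "avoidable l \<longleftrightarrow> (\<exists>\<theta> \<mu>. indep_rows {..<n} ({..<n+m} - {l}) (pencil \<theta> \<mu>))"

lemma resolvent_entry_nz_left_kernel:
  assumes M: "M \<in> carrier_mat n p" and nz: "resolvent_entry_nz A M l j" and l: "l < n"
    and j: "j < p"
  obtains v \<mu> where "row_times v (cmat M) j \<noteq> 0"
    and "\<forall>q. (\<forall>k<n. k \<noteq> l \<longrightarrow> (\<Sum>a<n. q a * base_pencil \<mu> a k) = 0) \<longrightarrow> (\<exists>c. \<forall>b<n. q b = c * v b)"
proof -
  obtain \<mu> R where R: "R \<in> carrier_mat n n" "R * (\<mu> \<cdot>\<^sub>m 1\<^sub>m n - cmat A) = 1\<^sub>m n"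
    and ne: "(R * cmat M) $$ (l,j) \<noteq> 0"
    using nz A unfolding resolvent_entry_nz_def by auto
  have N: "\<mu> \<cdot>\<^sub>m 1\<^sub>m n - cmat A \<in> carrier_mat n n" using cmat_A by (intro minus_carrier_mat)
  have "row_times q (\<mu> \<cdot>\<^sub>m 1\<^sub>m n - cmat A) k = (\<Sum>a<n. q a * base_pencil \<mu> a k)" if "k < n" for q k
    unfolding row_times_def carrier_matD(1)[OF N] using that
    by (simp add: resolvent_matrix_index del: index_minus_mat)
  then have kernel: "\<exists>c. \<forall>b<n. q b = c * R $$ (l,b)"
    if "\<forall>k<n. k \<noteq> l \<longrightarrow> (\<Sum>a<n. q a * base_pencil \<mu> a k) = 0" for q
    using left_kernel_off_column[OF R(1) N R(2) l, of _ q] that by auto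
  have "row_times (\<lambda>b. R $$ (l,b)) (cmat M) j = (R * cmat M) $$ (l,j)"
    using R(1) M l j by (simp add: row_times_def scalar_prod_def atLeast0LessThan)
  then show thesis using that[of "\<lambda>b. R $$ (l,b)" \<mu>] ne kernel by simp
qed

lemma avoidable_of_input_edge:
  assumes l: "l < n" and j: "j < m" and "resolvent_entry_nz A B l j"
  shows "avoidable l"
proof -
  obtain v \<mu> where v: "row_times v (cmat B) j \<noteq> 0"
    and kernel: "\<forall>q. (\<forall>k<n. k \<noteq> l \<longrightarrow> (\<Sum>a<n. q a * base_pencil \<mu> a k) = 0) \<longrightarrow>
      (\<exists>c. \<forall>b<n. q b = c * v b)"
    by (rule resolvent_entry_nz_left_kernel[OF B assms(3) l j])
  have "indep_rows {..<n} ({..<n+m} - {l}) (base_pencil \<mu>)"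
  proof (rule indep_rowsI)
    fix q a assume q: "\<And>k. k \<in> {..<n+m} - {l} \<Longrightarrow> (\<Sum>a<n. q a * base_pencil \<mu> a k) = 0"
      and a: "a \<in> {..<n}"
    then obtain c where c: "\<And>b. b < n \<Longrightarrow> q b = c * v b"
      using kernel[rule_format, of q] by auto
    have "0 = (\<Sum>b<n. q b * base_pencil \<mu> b (n + j))" using q j l by simp
    also have "\<dots> = row_times q (cmat B) j"
      using left_mult_pbh_poly(2)[OF A B j, of q \<mu>] by (simp add: free_pencil_zero)
    also have "\<dots> = c * row_times v (cmat B) j"
      unfolding row_times_scale[symmetric] using B c by (intro row_times_cong) simp
    finally have "c = 0" using v by simp
    then show "q a = 0" using c a by simp
  qed
  then show ?thesis unfolding avoidable_def by blast
qed

lemma avoidable_of_input_column: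
  assumes "n \<le> l"
  shows "avoidable l"
proof -
  obtain \<mu> where "\<not> eigenvalue (cmat A) \<mu>" using exists_not_eigenvalue by blast
  from indep_rows_pencil_of_not_eigenvalue[OF this]
  have "indep_rows {..<n} ({..<n+m} - {l}) (base_pencil \<mu>)"
    by (rule indep_rows_mono) (use assms in auto)
  then show ?thesis unfolding avoidable_def by blast
qed

lemma avoidable_of_state_edge:
  assumes l: "l < n" and j: "j < n" and "resolvent_entry_nz A (1\<^sub>m n) l j"
    and i: "(j,i) \<in> free" "avoidable i"
  shows "avoidable l"
proof -
  obtain v \<mu> where v: "row_times v (cmat (1\<^sub>m n)) j \<noteq> 0"
    and kernel: "\<forall>q. (\<forall>k<n. k \<noteq> l \<longrightarrow> (\<Sum>a<n. q a * base_pencil \<mu> a k) = 0) \<longrightarrow>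
      (\<exists>c. \<forall>b<n. q b = c * v b)"
    by (rule resolvent_entry_nz_left_kernel[OF one_carrier_mat assms(3) l j])
  have "indep_rows ({..<n} - {j}) ({..<n+m} - {l}) (base_pencil \<mu>)"
  proof (rule indep_rowsI)
    fix q a
    assume q: "\<And>k. k \<in> {..<n+m} - {l} \<Longrightarrow> (\<Sum>a\<in>{..<n} - {j}. q a * base_pencil \<mu> a k) = 0"
      and a: "a \<in> {..<n} - {j}"
    have "(\<Sum>a<n. (q(j := 0)) a * base_pencil \<mu> a k) =
        (\<Sum>a\<in>{..<n} - {j}. q a * base_pencil \<mu> a k)" for k
      using j by (simp add: sum.remove[of "{..<n}" j])
    then obtain c where c: "\<forall>b<n. (q(j := 0)) b = c * v b"
      using kernel[rule_format, of "q(j := 0)"] q by auto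
    have "c * v j = 0" using c[rule_format, OF j] by simp
    then have "c = 0" using v j by simp
    then show "q a = 0" using c[rule_format, of a] a by simp
  qed
  moreover obtain \<theta> \<nu> where "indep_rows {..<n} ({..<n+m} - {i}) (pencil \<theta> \<nu>)"
    using i(2) unfolding avoidable_def by blast
  ultimately show ?thesis
    unfolding avoidable_def using i(1) j by (intro free_pencil_avoids_column) (auto simp: free_iff)
qed

lemma reachable_imp_avoidable:
  assumes "reachable (Z i)"
  shows "avoidable i"
proof -
  define Q where "Q v = (case v of Z l \<Rightarrow> avoidable l
    | X j \<Rightarrow> \<exists>i. (j,i) \<in> free \<and> avoidable i
    | U _ \<Rightarrow> True)" for v
  obtain j where "(U j, Z i) \<in> (acg_edges A B PA PB)\<^sup>*"
    using assms unfolding input_reachable_def by blast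
  then have "Q (Z i)"
  proof (induction rule: rtrancl_induct)
    case base
    then show ?case by (simp add: Q_def)
  next
    case (step v w)
    from step.hyps(2) show ?case
    proof (cases rule: acg_edges_cases)
      case (1 l j)
      then show ?thesis
        using step.hyps(2) step.IH avoidable_of_state_edge by (auto simp: Q_def acg_edges_iff)
    next
      case (2 l j)
      then show ?thesis
        using step.hyps(2) avoidable_of_input_edge avoidable_of_input_column
        by (cases "l < n") (auto simp: Q_def acg_edges_iff)
    next
      case (3 l j)
      then show ?thesis using step.hyps(2) step.IH by (auto simp: Q_def acg_edges_iff)
    qed
  qed
  then show ?thesis by (simp add: Q_def)
qed

lemma struct_controllableI:
  assumes eigenvalues: "\<And>\<mu>. eigenvalue (cmat A) \<mu> \<Longrightarrow> \<exists>\<theta>. full_row_rank \<theta> \<mu>"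
    and reachable: "\<And>i. i < n + m \<Longrightarrow> reachable (Z i)"
  shows "struct_controllable A B PA PB"
  unfolding struct_controllable_iff_pencil
proof (rule generic_indep_rows)
  show "\<exists>\<theta> \<mu>. indep_rows {..<n} ({..<n+m} - {l}) (pencil \<theta> \<mu>)" if "l \<in> {..<n+m}" for l
    using reachable_imp_avoidable[OF reachable] that unfolding avoidable_def by simp
  show "\<exists>\<theta>. full_row_rank \<theta> \<mu>" for \<mu>
    using eigenvalues indep_rows_mono[OF indep_rows_pencil_of_not_eigenvalue[of \<mu>], of "{..<n+m}"]
    by (cases "eigenvalue (cmat A) \<mu>") auto
qed simp_all

subsection \<open>Necessity\<close>

text \<open>The hidden row vectors form the largest \<open>A\<close>-invariant space of row vectors that annihilate
  \<open>B\<close> and vanish at the reachable \<open>x\<^sub>j\<close>.\<close>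

definition hidden :: "(nat \<Rightarrow> complex) \<Rightarrow> bool" where
  "hidden w \<longleftrightarrow> (\<forall>k. (\<forall>j<m. row_times w (cmat A ^\<^sub>m k * cmat B) j = 0) \<and>
     (\<forall>j<n. reachable (X j) \<longrightarrow> row_times w (cmat A ^\<^sub>m k) j = 0))"

lemma hidden_cong: "(\<And>a. a < n \<Longrightarrow> w a = w' a) \<Longrightarrow> hidden w \<longleftrightarrow> hidden w'"
  unfolding hidden_def row_times_def using A by simp

lemma hidden_add: "hidden w \<Longrightarrow> hidden w' \<Longrightarrow> hidden (\<lambda>a. w a + w' a)"
  unfolding hidden_def by (simp add: row_times_add)

lemma hidden_imp_eq_0:
  assumes "hidden w" "j < n" "reachable (X j)"
  shows "w j = 0"
proof -
  have "row_times w (cmat A ^\<^sub>m 0) j = 0" using assms unfolding hidden_def by blast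
  then show ?thesis using A assms(2) by simp
qed

lemma hidden_row_times_A:
  assumes "hidden w"
  shows "hidden (row_times w (cmat A))"
proof -
  have Ak: "cmat A ^\<^sub>m k \<in> carrier_mat n n" for k using A by simp
  have "row_times (row_times w (cmat A)) (cmat A ^\<^sub>m k) j = row_times w (cmat A ^\<^sub>m Suc k) j"
    if "j < n" for k j
    unfolding pow_mat_Suc_left[OF cmat_A] by (rule row_times_mult[OF cmat_A Ak that, symmetric])
  moreover have "row_times (row_times w (cmat A)) (cmat A ^\<^sub>m k * cmat B) j =
      row_times w (cmat A ^\<^sub>m Suc k * cmat B) j" if "j < m" for k j
    unfolding pow_mat_Suc_left[OF cmat_A] assoc_mult_mat[OF cmat_A Ak cmat_B]
    by (rule row_times_mult[OF cmat_A mult_carrier_mat[OF Ak cmat_B] that, symmetric])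
  ultimately show ?thesis using assms unfolding hidden_def by (simp del: pow_mat.simps)
qed

lemma hidden_of_unreachable_support:
  assumes support: "\<And>i. i < n \<Longrightarrow> reachable (Z i) \<Longrightarrow> w i = 0"
  shows "hidden w"
proof -
  have B_zero: "(cmat A ^\<^sub>m k * cmat B) $$ (i,j) = 0"
    if "i < n" "\<not> reachable (Z i)" "j < m" for i j k
  proof (rule resolvent_numerator_eq_0_imp_pow_eq_0[OF cmat_A cmat_B that(1,3)])
    show "resolvent_numerator (cmat A) (cmat B) $$ (i,j) = 0"
      using reachable_step[OF reachable_input[OF that(3)], of "Z i"] that
      by (auto simp: acg_edges_iff resolvent_entry_nz_iff[OF A B])
  qed
  have X_zero: "(cmat A ^\<^sub>m k) $$ (i,j) = 0"
    if "i < n" "\<not> reachable (Z i)" "j < n" "reachable (X j)" for i j k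
  proof -
    have "resolvent_numerator (cmat A) (1\<^sub>m n) $$ (i,j) = 0"
      using reachable_step[OF that(4), of "Z i"] that
      by (auto simp: acg_edges_iff resolvent_entry_nz_iff[OF A one_carrier_mat])
    then have "(cmat A ^\<^sub>m k * 1\<^sub>m n) $$ (i,j) = 0"
      by (rule resolvent_numerator_eq_0_imp_pow_eq_0[OF cmat_A one_carrier_mat that(1,3)])
    then show ?thesis using A right_mult_one_mat[of "cmat A ^\<^sub>m k" n n] by simp
  qed
  have "w i * (cmat A ^\<^sub>m k * cmat B) $$ (i,j) = 0" if "i < n" "j < m" for i j k
    using support B_zero that by (cases "reachable (Z i)") auto
  moreover have "w i * (cmat A ^\<^sub>m k) $$ (i,j) = 0" if "i < n" "j < n" "reachable (X j)" for i j k
    using support X_zero that by (cases "reachable (Z i)") auto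
  ultimately show ?thesis
    using A unfolding hidden_def row_times_def by (simp del: mult_eq_0_iff)
qed

lemma hidden_row_times_dA:
  assumes w: "hidden w"
  shows "hidden (row_times w (cmat (dA \<theta>)))"
proof (rule hidden_of_unreachable_support)
  fix i assume i: "i < n" "reachable (Z i)"
  have "w a * cmat (dA \<theta>) $$ (a,i) = 0" if "a < n" for a
    using hidden_imp_eq_0[OF w that] reachable_step[OF i(2), of "X a"] that i(1)
    by (auto simp: dA_def acg_edges_iff)
  then show "row_times w (cmat (dA \<theta>)) i = 0" by (simp add: row_times_def del: mult_eq_0_iff)
qed

lemma hidden_row_times_perturbed_A:
  assumes w: "hidden w"
  shows "hidden (row_times w (cmat (A + dA \<theta>)))"
proof -
  have "row_times w (cmat (A + dA \<theta>)) b = row_times w (cmat A) b + row_times w (cmat (dA \<theta>)) b"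
    if "b < n" for b
    unfolding cmat_add[OF A dA_carrier] by (rule row_times_add_mat[OF cmat_A _ that]) simp
  from hidden_cong[OF this] show ?thesis
    using hidden_add[OF hidden_row_times_A[OF w] hidden_row_times_dA[OF w]] by simp
qed

lemma hidden_row_times_perturbed_B:
  assumes w: "hidden w" and j: "j < m"
  shows "row_times w (cmat (B + dB \<theta>)) j = 0"
proof -
  have "w a * cmat (dB \<theta>) $$ (a,j) = 0" if "a < n" for a
    using hidden_imp_eq_0[OF w that]
      reachable_step[OF reachable_Z_input[of "n + j"], of "X a"] that j
    by (auto simp: dB_def acg_edges_iff)
  then have "row_times w (cmat (dB \<theta>)) j = 0" by (simp add: row_times_def del: mult_eq_0_iff)
  moreover have "row_times w (cmat A ^\<^sub>m 0 * cmat B) j = 0" using w j unfolding hidden_def by blast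
  ultimately show ?thesis
    unfolding cmat_add[OF B dB_carrier]
    using A B cmat_B by (simp add: row_times_add_mat[OF cmat_B _ j])
qed

lemma struct_controllable_imp_reachable:
  assumes "struct_controllable A B PA PB" and i: "i < n + m"
  shows "reachable (Z i)"
proof (rule ccontr)
  assume unreachable: "\<not> reachable (Z i)"
  then have "i < n" using reachable_Z_input[of i] i by (meson not_le_imp_less)
  obtain \<theta> where controllable: "controllable (A + dA \<theta>) (B + dB \<theta>)"
    using assms(1) unfolding struct_controllable_iff_parameter by blast
  let ?A = "A + dA \<theta>" and ?B = "B + dB \<theta>" and ?e = "\<lambda>a. of_bool (a = i) :: complex"
  have A': "?A \<in> carrier_mat n n" and B': "?B \<in> carrier_mat n m" by auto
  have hidden: "hidden (row_times ?e (cmat ?A ^\<^sub>m k))" for k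
  proof (induction k)
    case 0
    have "hidden ?e" using unreachable by (intro hidden_of_unreachable_support) auto
    also have "hidden ?e \<longleftrightarrow> hidden (row_times ?e (cmat ?A ^\<^sub>m 0))"
      by (rule hidden_cong) (use A' in simp)
    finally show ?case .
  next
    case (Suc k)
    have "row_times ?e (cmat ?A ^\<^sub>m Suc k) b = row_times (row_times ?e (cmat ?A ^\<^sub>m k)) (cmat ?A) b"
      if "b < n" for b
      using A' that by (simp add: row_times_mult[of _ n n _ n])
    from hidden_cong[OF this] show ?case using hidden_row_times_perturbed_A[OF Suc] by simp
  qed
  have "row_times ?e (cmat ?A ^\<^sub>m k * cmat ?B) j = 0" if "j < m" for k j
  proof -
    have "row_times ?e (cmat ?A ^\<^sub>m k * cmat ?B) j =
        row_times (row_times ?e (cmat ?A ^\<^sub>m k)) (cmat ?B) j"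
      using A' B' that by (intro row_times_mult[of _ n n _ m]) auto
    then show ?thesis using hidden_row_times_perturbed_B[OF hidden that] by simp
  qed
  then have "?e i = 0"
    using controllable \<open>i < n\<close> unfolding controllable_iff_annihilator[OF A' B'] by blast
  then show False by simp
qed

lemma struct_controllable_iff_rank_and_reachable:
  "struct_controllable A B PA PB \<longleftrightarrow>
     (\<forall>\<mu>. eigenvalue (cmat A) \<mu> \<longrightarrow> (\<exists>\<theta>. full_row_rank \<theta> \<mu>)) \<and>
     (\<forall>i < n + m. reachable (Z i))"
  using struct_controllableI struct_controllable_imp_reachable struct_controllable_iff_pencil
  by blast

end

section \<open>Matroid intersection\<close>

lemma pick_lessThan: "i < r \<Longrightarrow> pick {..<r} i = i"
proof -
  assume i: "i < r"
  then have "{a \<in> {..<r}. a < i} = {..<i}" by auto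
  then show ?thesis using pick_card_in_set[of i "{..<r}"] i by simp
qed

lemma bij_betw_pick:
  assumes "finite I"
  shows "bij_betw (pick I) {..<card I} I"
proof -
  have "I \<subseteq> pick I ` {..<card I}"
  proof
    fix k assume k: "k \<in> I"
    have "card {a \<in> I. a < k} < card I"
      using k assms by (intro psubset_card_mono) auto
    then show "k \<in> pick I ` {..<card I}"
      by (intro image_eqI[of _ _ "card {a \<in> I. a < k}"]) (simp_all add: pick_card_in_set[OF k])
  qed
  moreover have "pick I ` {..<card I} \<subseteq> I" by (auto intro: pick_in_set_le)
  ultimately have image: "pick I ` {..<card I} = I" by blast
  then have "inj_on (pick I) {..<card I}" by (intro eq_card_imp_inj_on) auto
  then show ?thesis using image by (simp add: bij_betw_def)
qed

lemma
  assumes "M \<in> carrier_mat r c" "I \<subseteq> {..<c}"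
  shows submatrix_lessThan_carrier: "submatrix M {..<r} I \<in> carrier_mat r (card I)"
    and submatrix_lessThan_index:
      "a < r \<Longrightarrow> j < card I \<Longrightarrow> submatrix M {..<r} I $$ (a,j) = M $$ (a, pick I j)"
proof -
  have rows: "{i. i < dim_row M \<and> i \<in> {..<r}} = {..<r}" using assms(1) by auto
  have cols: "{j. j < dim_col M \<and> j \<in> I} = I" using assms by auto
  show "submatrix M {..<r} I \<in> carrier_mat r (card I)"
    by (simp add: submatrix_def rows[simplified] cols)
  show "submatrix M {..<r} I $$ (a,j) = M $$ (a, pick I j)" if "a < r" "j < card I"
    using submatrix_index[of a M "{..<r}" j I] that unfolding rows cols by (simp add: pick_lessThan)
qed

lemma rank_submatrix_eq_card_iff:
  assumes M: "M \<in> carrier_mat r c" and I: "I \<subseteq> {..<c}"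
  shows "vec_space.rank r (submatrix M {..<r} I) = card I \<longleftrightarrow> indep_rows I {..<r} (\<lambda>k a. M $$ (a,k))"
proof -
  have "vec_space.rank r (submatrix M {..<r} I) = card I \<longleftrightarrow>
      indep_rows {..<card I} {..<r} (\<lambda>j a. submatrix M {..<r} I $$ (a,j))"
    by (rule rank_eq_dim_col_iff[OF submatrix_lessThan_carrier[OF M I]])
  also have "\<dots> \<longleftrightarrow> indep_rows {..<card I} {..<r} (\<lambda>j a. M $$ (a, pick I j))"
    by (rule indep_rows_cong) (simp add: submatrix_lessThan_index[OF M I])
  also have "\<dots> \<longleftrightarrow> indep_rows I {..<r} (\<lambda>k a. M $$ (a,k))"
    by (rule indep_rows_bij_betw[where f = "\<lambda>a. a"])
       (use bij_betw_pick[of I] finite_subset[OF I] in auto)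
  finally show ?thesis .
qed

lemma col_indep_iff:
  assumes "W \<in> carrier_mat r c"
  shows "col_indep W I \<longleftrightarrow> I \<subseteq> {..<c} \<and> indep_rows I {..<r} (\<lambda>k a. W $$ (a,k))"
  using assms unfolding col_indep_def by (auto simp: rank_submatrix_eq_card_iff[OF assms])

lemma pattern_col_indep_iff:
  assumes P: "P \<in> carrier_mat r c"
  shows "pattern_col_indep P I \<longleftrightarrow>
    I \<subseteq> {..<c} \<and> (\<exists>M \<in> realizations P. indep_rows I {..<r} (\<lambda>k a. M $$ (a,k)))"
proof (cases "I \<subseteq> {..<c}")
  case I: True
  have carrier: "M \<in> carrier_mat r c" if "M \<in> realizations P" for M
    using that P by (simp add: realizations_def)
  have nonempty: "realizations P \<noteq> {}"
    using P by (auto simp: realizations_def intro!: exI[of _ "0\<^sub>m r c"])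
  let ?rank = "\<lambda>M :: real mat. vec_space.rank r (submatrix M {..<r} I)"
  have "{?rank M | M. M \<in> realizations P} = ?rank ` realizations P" by blast
  moreover have "Max (?rank ` realizations P) = card I \<longleftrightarrow> card I \<in> ?rank ` realizations P"
    using nonempty vec_space.rank_le_nc[OF submatrix_lessThan_carrier[OF carrier I]]
    by (intro Max_eq_bound_iff) auto
  moreover have "card I \<in> ?rank ` realizations P \<longleftrightarrow>
      (\<exists>M \<in> realizations P. indep_rows I {..<r} (\<lambda>k a. M $$ (a,k)))"
    unfolding image_iff eq_commute[of "card I"]
    by (intro bex_cong refl rank_submatrix_eq_card_iff[OF carrier I])
  ultimately show ?thesis using P I unfolding pattern_col_indep_def by simp
qed (use P in \<open>auto simp: pattern_col_indep_def\<close>)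

lemma indep_rows_mult_imp_transversal:
  fixes c :: "nat \<Rightarrow> nat \<Rightarrow> 'a::field"
  assumes "indep_rows {..<n} {..<n} (\<lambda>b a. \<Sum>k<N. c b k * h k a)"
  obtains g where "\<forall>b<n. g b < N \<and> c b (g b) \<noteq> 0" and "indep_rows {..<n} {..<n} (\<lambda>b. h (g b))"
proof -
  define C where "C = mat n N (\<lambda>(b,k). c b k)"
  define H where "H = mat N n (\<lambda>(k,a). h k a)"
  have carriers: "C \<in> carrier_mat n N" "H \<in> carrier_mat N n" by (auto simp: C_def H_def)
  have "C * H = mat n n (\<lambda>(b,a). \<Sum>k<N. c b k * h k a)"
    by (intro eq_matI) (auto simp: C_def H_def scalar_prod_def atLeast0LessThan)
  then have "det (C * H) \<noteq> 0" using assms unfolding det_ne_0_iff_indep_rows[symmetric] by simp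
  moreover have "det (C * H) = (\<Sum>g | (\<forall>b\<in>{0..<n}. g b \<in> {0..<N}) \<and> (\<forall>b. b \<notin> {0..<n} \<longrightarrow> g b = b).
      det (mat\<^sub>r n n (\<lambda>b. C $$ (b, g b) \<cdot>\<^sub>v row H (g b))))"
    unfolding mat_mul_finsum_alt[OF carriers] by (rule det_linear_rows_sum) (use carriers in auto)
  ultimately obtain g where g: "\<forall>b\<in>{0..<n}. g b \<in> {0..<N}"
    and "det (mat\<^sub>r n n (\<lambda>b. C $$ (b, g b) \<cdot>\<^sub>v row H (g b))) \<noteq> 0"
    by (metis (no_types, lifting) mem_Collect_eq sum.neutral)
  moreover have "row H (g b) \<in> carrier_vec n" for b using carriers(2) by (auto simp: row_def)
  ultimately have "prod (\<lambda>b. C $$ (b, g b)) {0..<n} * det (mat\<^sub>r n n (\<lambda>b. row H (g b))) \<noteq> 0"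
    by (subst (asm) det_rows_mul) auto
  moreover have "mat\<^sub>r n n (\<lambda>b. row H (g b)) = mat n n (\<lambda>(b,a). h (g b) a)"
    using g by (intro eq_matI) (auto simp: H_def)
  ultimately show thesis
    using that[of g] g by (auto simp: C_def det_ne_0_iff_indep_rows)
qed

lemma indep_rows_rescale_cols:
  fixes p h :: "'i \<Rightarrow> 'k \<Rightarrow> complex" and d :: "'k \<Rightarrow> real"
  assumes "finite I" "finite K" "indep_rows I K (\<lambda>i k. p i k + h i k * of_real (d k))"
  obtains s :: "'k \<Rightarrow> real" where "indep_rows I K (\<lambda>i k. p i k * of_real (s k) + h i k)"
proof -
  define Q where "Q i k = [:p i k + h i k * of_real (d k), h i k:]" for i k
  let ?D = "{\<mu>. \<not> indep_rows I K (\<lambda>i k. poly (Q i k) \<mu>)}"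
  have "indep_rows I K (\<lambda>i k. poly (Q i k) 0)" using assms(3) by (simp add: Q_def)
  then have "finite ?D" by (rule finite_dependent_poly_matrix[OF assms(1,2)])
  then have "finite (complex_of_real -` ?D)" by (rule finite_vimageI) (simp add: inj_def)
  then have "finite (complex_of_real -` ?D \<union> (\<lambda>k. - d k) ` K)" using assms(2) by simp
  then obtain \<epsilon> where "\<epsilon> \<notin> complex_of_real -` ?D \<union> (\<lambda>k. - d k) ` K"
    using ex_new_if_finite[OF infinite_UNIV_char_0] by blast
  then have indep: "indep_rows I K (\<lambda>i k. poly (Q i k) (of_real \<epsilon>))"
    and ne: "\<And>k. k \<in> K \<Longrightarrow> d k + \<epsilon> \<noteq> 0"
    by (auto simp: add_eq_0_iff)
  define s where "s k = 1 / (d k + \<epsilon>)" for k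
  have "poly (Q i k) (of_real \<epsilon>) = (p i k * of_real (s k) + h i k) * of_real (d k + \<epsilon>)"
    if "k \<in> K" for i k
  proof -
    have "of_real (s k) * complex_of_real (d k + \<epsilon>) = 1"
      unfolding of_real_mult[symmetric] using ne[OF that] by (simp add: s_def del: of_real_add)
    then have "(p i k * of_real (s k) + h i k) * of_real (d k + \<epsilon>) =
        p i k + h i k * of_real (d k + \<epsilon>)"
      by (simp add: distrib_right mult.assoc del: of_real_add)
    then show ?thesis by (simp add: Q_def algebra_simps)
  qed
  then have "indep_rows I K (\<lambda>i k. (p i k * of_real (s k) + h i k) * of_real (d k + \<epsilon>))"
    using indep by (subst (asm) indep_rows_cong) auto
  then have "indep_rows I K (\<lambda>i k. p i k * of_real (s k) + h i k)"
    by (subst (asm) indep_rows_scale_cols) (use ne in \<open>auto simp del: of_real_add\<close>)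
  then show thesis by (rule that)
qed

context perturbed_system
begin

definition num_entry :: "complex \<Rightarrow> nat \<Rightarrow> nat \<Rightarrow> complex" where
  "num_entry \<mu> a k = (if k < n then of_bool (a = k) else base_pencil \<mu> a (k - n))"

lemma W_num_carrier: "W_num A B \<mu> \<in> carrier_mat n (2 * n + m)"
proof -
  have "W_num A B \<mu> \<in> carrier_mat n ((n + n) + m)"
    unfolding W_num_def using A B by (intro hconcat_carrier) (auto intro!: minus_carrier_mat)
  then show ?thesis by (simp add: mult_2)
qed

lemma W_num_index:
  assumes "a < n" "k < 2 * n + m"
  shows "W_num A B \<mu> $$ (a,k) = num_entry \<mu> a k"
  using assms A B
  by (auto simp: W_num_def hconcat_def num_entry_def free_pencil_def pbh_poly_def not_less)

lemma W_pattern_carrier: "W_pattern PA PB \<in> carrier_mat (n + m) (2 * n + m)"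
  using PA PB by (auto simp: W_pattern_def hconcat_def diag_pattern_def)

lemma W_pattern_index:
  assumes "r < n + m" "k < 2 * n + m"
  shows "W_pattern PA PB $$ (r,k) \<longleftrightarrow> (if k < n then (k,r) \<in> free else k = n + r)"
  using assms PA PB by (auto simp: W_pattern_def hconcat_def diag_pattern_def free_def)

lemma pencil_eq_base_plus_free:
  "pencil \<theta> \<mu> a k = base_pencil \<mu> a k + (if (a,k) \<in> free then of_real (\<theta> (a,k)) else 0)"
  by (simp add: free_pencil_def)

lemma realization_W_pattern_eq_0:
  assumes "M \<in> realizations (W_pattern PA PB)" "r < n + m" "k < 2 * n + m"
    and "\<not> (if k < n then (k,r) \<in> free else k = n + r)"
  shows "M $$ (r,k) = 0"
  using assms W_pattern_carrier W_pattern_index[OF assms(2,3)] unfolding realizations_def by auto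

lemma num_entry_mult_realization:
  assumes M: "M \<in> realizations (W_pattern PA PB)" and I: "I \<subseteq> {..<2 * n + m}" and a: "a < n"
    and r: "r < n + m"
  shows "(\<Sum>k\<in>I. num_entry \<mu> a k * of_real (M $$ (r,k))) =
    of_real (of_bool (a \<in> I) * M $$ (r,a)) +
    base_pencil \<mu> a r * of_real (of_bool (n + r \<in> I) * M $$ (r, n + r))"
proof -
  have fin: "finite I" using I finite_subset by blast
  have "(\<Sum>k\<in>I. num_entry \<mu> a k * of_real (M $$ (r,k))) =
      (\<Sum>k\<in>I. (if k = a then of_real (M $$ (r,a)) else 0) +
        (if k = n + r then base_pencil \<mu> a r * of_real (M $$ (r, n + r)) else 0))"
  proof (rule sum.cong[OF refl])
    fix k assume "k \<in> I"
    then have "k < 2 * n + m" using I by auto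
    from realization_W_pattern_eq_0[OF M r this]
    show "num_entry \<mu> a k * of_real (M $$ (r,k)) = (if k = a then of_real (M $$ (r,a)) else 0) +
        (if k = n + r then base_pencil \<mu> a r * of_real (M $$ (r, n + r)) else 0)"
      using a by (auto simp: num_entry_def)
  qed
  then show ?thesis using fin by (simp add: sum.distrib)
qed

lemma common_independent_imp_indep_pencil:
  assumes I: "I \<subseteq> {..<2 * n + m}" "card I = n"
    and num: "indep_rows I {..<n} (\<lambda>k a. num_entry \<mu> a k)"
    and M: "M \<in> realizations (W_pattern PA PB)"
    and pattern: "indep_rows I {..<n+m} (\<lambda>k r. M $$ (r,k))"
  shows "\<exists>\<theta>. full_row_rank \<theta> \<mu>"
proof -
  have fin: "finite I" using I finite_subset by blast
  let ?q = "\<lambda>a r. of_bool (a \<in> I) * M $$ (r,a)"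
  let ?d = "\<lambda>r. of_bool (n + r \<in> I) * M $$ (r, n + r)"
  have "indep_rows {..<n} I (num_entry \<mu>)"
    using num fin I(2) by (subst indep_rows_transpose) auto
  moreover have "indep_rows I {..<n+m} (\<lambda>k r. complex_of_real (M $$ (r,k)))"
    using pattern by (simp add: indep_rows_complex_of_real)
  ultimately have "indep_rows {..<n} {..<n+m} (\<lambda>a r. \<Sum>k\<in>I. num_entry \<mu> a k * of_real (M $$ (r,k)))"
    by (rule indep_rows_mult[OF fin])
  then have "indep_rows {..<n} {..<n+m}
      (\<lambda>a r. of_real (?q a r) + base_pencil \<mu> a r * of_real (?d r))"
    by (subst (asm) indep_rows_cong) (auto simp: num_entry_mult_realization[OF M I(1)])
  then obtain s where
    "indep_rows {..<n} {..<n+m} (\<lambda>a r. of_real (?q a r) * of_real (s r) + base_pencil \<mu> a r)"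
    by (rule indep_rows_rescale_cols[rotated 2]) auto
  moreover have "of_real (?q a r) * of_real (s r) + base_pencil \<mu> a r =
      pencil (\<lambda>(a,r). ?q a r * s r) \<mu> a r" if "a < n" "r < n + m" for a r
  proof -
    have "M $$ (r,a) = 0" if "(a,r) \<notin> free"
      using realization_W_pattern_eq_0[OF M, of r a] \<open>a < n\<close> \<open>r < n + m\<close> that by simp
    then show ?thesis unfolding pencil_eq_base_plus_free[of "\<lambda>(a,r). ?q a r * s r"] by simp
  qed
  ultimately have "full_row_rank (\<lambda>(a,r). ?q a r * s r) \<mu>"
    by (subst (asm) indep_rows_cong) auto
  then show ?thesis by blast
qed

lemma matching_realization:
  fixes f g :: "nat \<Rightarrow> nat"
  assumes f: "inj_on f {..<p}" "f ` {..<p} \<subseteq> {..<r}" and g: "inj_on g {..<p}" "g ` {..<p} \<subseteq> {..<c}"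
    and P: "P \<in> carrier_mat r c" "\<And>b. b < p \<Longrightarrow> P $$ (f b, g b)"
  shows "\<exists>M \<in> realizations P. indep_rows (g ` {..<p}) {..<r} (\<lambda>k a. M $$ (a,k))"
proof
  let ?M = "mat r c (\<lambda>(a,k). of_bool (\<exists>b<p. a = f b \<and> k = g b)) :: real mat"
  show "?M \<in> realizations P" using P by (auto simp: realizations_def)
  have "indep_rows {..<p} {..<p} (\<lambda>b b'. ?M $$ (f b', g b))"
  proof (rule indep_rowsI)
    fix q b assume kernel: "\<And>b'. b' \<in> {..<p} \<Longrightarrow> (\<Sum>b<p. q b * ?M $$ (f b', g b)) = 0"
      and b: "b \<in> {..<p}"
    have "?M $$ (f b, g b') = of_bool (b' = b)" if "b' < p" for b'
      using that b f g by (auto simp: inj_on_eq_iff image_subset_iff)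
    then show "q b = 0" using kernel[OF b] b by simp
  qed
  then have "indep_rows (g ` {..<p}) (f ` {..<p}) (\<lambda>k a. ?M $$ (a,k))"
    by (subst (asm) indep_rows_bij_betw) (use g(1) in \<open>auto simp: bij_betw_def\<close>)
  then show "indep_rows (g ` {..<p}) {..<r} (\<lambda>k a. ?M $$ (a,k))"
    using f(2) by (rule indep_rows_mono)
qed

definition pattern_entry :: "(nat \<times> nat \<Rightarrow> real) \<Rightarrow> nat \<Rightarrow> nat \<Rightarrow> complex" where
  "pattern_entry \<theta> r k = (if k < n then if (k,r) \<in> free then of_real (\<theta> (k,r)) else 0
     else of_bool (k = n + r))"

lemma pencil_eq_sum_pattern_num_entry:
  assumes "a < n" "r < n + m"
  shows "pencil \<theta> \<mu> a r = (\<Sum>k<2 * n + m. pattern_entry \<theta> r k * num_entry \<mu> a k)"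
proof -
  have "(\<Sum>k<2 * n + m. pattern_entry \<theta> r k * num_entry \<mu> a k) = (\<Sum>k<2 * n + m.
      (if k = a then pattern_entry \<theta> r a else 0) + (if k = n + r then base_pencil \<mu> a r else 0))"
    using assms by (intro sum.cong) (auto simp: num_entry_def pattern_entry_def)
  also have "\<dots> = pattern_entry \<theta> r a + base_pencil \<mu> a r"
    using assms by (simp add: sum.distrib)
  finally show ?thesis
    unfolding pencil_eq_base_plus_free[of \<theta>] using assms(1) by (simp add: pattern_entry_def)
qed

lemma indep_pencil_imp_common_independent:
  assumes "full_row_rank \<theta> \<mu>"
  obtains I M where "I \<subseteq> {..<2 * n + m}" "card I = n" "indep_rows I {..<n} (\<lambda>k a. num_entry \<mu> a k)"
    "M \<in> realizations (W_pattern PA PB)" "indep_rows I {..<n+m} (\<lambda>k r. M $$ (r,k))"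
proof -
  obtain J where J: "J \<subseteq> {..<n+m}" "card J = n" "indep_rows {..<n} J (pencil \<theta> \<mu>)"
    using indep_rows_basis[OF _ _ assms] by auto
  have finJ: "finite J" using J(1) finite_subset by blast
  then obtain f where f: "bij_betw f {..<n} J"
    using J(2) ex_bij_betw_nat_finite atLeast0LessThan by metis
  then have f_less: "f b < n + m" if "b < n" for b using J(1) that by (auto simp: bij_betw_def)
  have "indep_rows J {..<n} (\<lambda>k a. pencil \<theta> \<mu> a k)"
    using J finJ by (subst (asm) indep_rows_transpose) auto
  then have "indep_rows {..<n} {..<n} (\<lambda>b a. pencil \<theta> \<mu> a (f b))"
    using indep_rows_bij_betw[OF finite_lessThan f image_ident, of "{..<n}" "\<lambda>k a. pencil \<theta> \<mu> a k"]
    by simp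
  then have "indep_rows {..<n} {..<n}
      (\<lambda>b a. \<Sum>k<2 * n + m. pattern_entry \<theta> (f b) k * num_entry \<mu> a k)"
    by (subst (asm) indep_rows_cong) (auto simp: pencil_eq_sum_pattern_num_entry f_less)
  then obtain g where g: "\<forall>b<n. g b < 2 * n + m \<and> pattern_entry \<theta> (f b) (g b) \<noteq> 0"
    and indep: "indep_rows {..<n} {..<n} (\<lambda>b a. num_entry \<mu> a (g b))"
    by (rule indep_rows_mult_imp_transversal)
  have inj: "inj_on g {..<n}" and num: "indep_rows (g ` {..<n}) {..<n} (\<lambda>k a. num_entry \<mu> a k)"
    using indep indep_rows_reindex[of "{..<n}" "{..<n}" "\<lambda>k a. num_entry \<mu> a k" g] by auto
  have "W_pattern PA PB $$ (f b, g b)" if "b < n" for b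
    using g[rule_format, OF that] f_less[OF that]
    by (auto simp: W_pattern_index pattern_entry_def split: if_splits)
  then obtain M where "M \<in> realizations (W_pattern PA PB)"
    "indep_rows (g ` {..<n}) {..<n+m} (\<lambda>k r. M $$ (r,k))"
    using matching_realization[of f n "n + m" g "2 * n + m", OF _ _ inj _ W_pattern_carrier]
      f J(1) g
    by (auto simp: bij_betw_def image_subset_iff)
  then show thesis
    using that[of "g ` {..<n}" M] g num inj by (auto simp: card_image)
qed

lemma common_independent_iff:
  "col_indep (W_num A B \<mu>) I \<and> pattern_col_indep (W_pattern PA PB) I \<longleftrightarrow>
    I \<subseteq> {..<2 * n + m} \<and> indep_rows I {..<n} (\<lambda>k a. num_entry \<mu> a k) \<and>
    (\<exists>M \<in> realizations (W_pattern PA PB). indep_rows I {..<n+m} (\<lambda>k r. M $$ (r,k)))"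
proof -
  have "indep_rows I {..<n} (\<lambda>k a. W_num A B \<mu> $$ (a,k)) \<longleftrightarrow>
      indep_rows I {..<n} (\<lambda>k a. num_entry \<mu> a k)"
    if "I \<subseteq> {..<2 * n + m}"
    using that by (intro indep_rows_cong W_num_index) auto
  then show ?thesis
    unfolding col_indep_iff[OF W_num_carrier] pattern_col_indep_iff[OF W_pattern_carrier] by auto
qed

lemma exists_common_independent_iff:
  "(\<exists>I. card I = n \<and> col_indep (W_num A B \<mu>) I \<and> pattern_col_indep (W_pattern PA PB) I) \<longleftrightarrow>
    (\<exists>\<theta>. full_row_rank \<theta> \<mu>)"
  unfolding common_independent_iff
proof
  assume "\<exists>\<theta>. full_row_rank \<theta> \<mu>"
  then obtain \<theta> where "full_row_rank \<theta> \<mu>" by blast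
  then show "\<exists>I. card I = n \<and> I \<subseteq> {..<2 * n + m} \<and> indep_rows I {..<n} (\<lambda>k a. num_entry \<mu> a k) \<and>
      (\<exists>M \<in> realizations (W_pattern PA PB). indep_rows I {..<n+m} (\<lambda>k r. M $$ (r,k)))"
    by (rule indep_pencil_imp_common_independent) auto
qed (use common_independent_imp_indep_pencil in auto)

lemma matroid_inter_card_iff:
  "matroid_inter_card (2 * n + m) (col_indep (W_num A B \<mu>))
      (pattern_col_indep (W_pattern PA PB)) = n \<longleftrightarrow> (\<exists>\<theta>. full_row_rank \<theta> \<mu>)"
proof -
  define F where "F = {I. I \<subseteq> {..<2 * n + m} \<and>
    col_indep (W_num A B \<mu>) I \<and> pattern_col_indep (W_pattern PA PB) I}"
  have "0\<^sub>m (n + m) (2 * n + m) \<in> realizations (W_pattern PA PB)"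
    using W_pattern_carrier by (auto simp: realizations_def)
  then have "{} \<in> F" unfolding F_def mem_Collect_eq common_independent_iff indep_rows_def by auto
  moreover have "card I \<le> n" if "I \<in> F" for I
  proof -
    have I: "I \<subseteq> {..<2 * n + m}" "indep_rows I {..<n} (\<lambda>k a. num_entry \<mu> a k)"
      using that by (simp_all add: F_def common_independent_iff)
    show ?thesis
      using indep_rows_imp_card_le[OF finite_subset[OF I(1)] finite_lessThan I(2)] by simp
  qed
  ultimately have "Max (card ` F) = n \<longleftrightarrow> n \<in> card ` F" by (intro Max_eq_bound_iff) auto
  also have "\<dots> \<longleftrightarrow> (\<exists>I. card I = n \<and> col_indep (W_num A B \<mu>) I \<and>
      pattern_col_indep (W_pattern PA PB) I)"
    unfolding F_def image_iff using common_independent_iff by auto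
  finally show ?thesis
    unfolding exists_common_independent_iff matroid_inter_card_def F_def setcompr_eq_image .
qed

end

theorem theorem1:
  fixes A B :: "real mat" and PA PB :: "bool mat" and n m :: nat
  assumes "A \<in> carrier_mat n n" and "B \<in> carrier_mat n m"
    and "PA \<in> carrier_mat n n" and "PB \<in> carrier_mat n m"
  shows "(struct_controllable A B PA PB \<longleftrightarrow>
           ((\<forall>lam. eigenvalue (cmat A) lam \<longrightarrow> max_pert_rank A B PA PB lam = n) \<and>
            (\<forall>e \<in> E_xz A B. edge_input_reachable A B PA PB e)))
       \<and> (struct_controllable A B PA PB \<longleftrightarrow>
           ((\<forall>lam. eigenvalue (cmat A) lam \<longrightarrow>
               matroid_inter_card (2 * n + m) (col_indep (W_num A B lam))
                 (pattern_col_indep (W_pattern PA PB)) = n) \<and>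
            (\<forall>i < n + m. input_reachable A B PA PB (Z i))))"
proof -
  interpret perturbed_system A B PA PB n m by unfold_locales (use assms in auto)
  show ?thesis
    unfolding struct_controllable_iff_rank_and_reachable max_pert_rank_iff
      matroid_inter_card_iff edge_input_reachable_iff_reachable_Z by blast
qed

end
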